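(* Let $\nu\ge2$. There exist $\delta_0=\delta_0(\nu)\in(0,1)$ and positive constants $C=C(\nu)$, $D=D(\nu)$, $C'=C'(\nu)$ such that the following holds. Let $0<\epsilon\le\frac{2}{2+\nu}$, $0<\delta\le\delta_0$, and let $N=2^n$ ($n\in\mathbb N$) be such that $\delta^\epsilon N=2^m$ for some integer $0\le m\le n$ (so that $\delta^{-\epsilon}\in\mathbb N$). Let $P\in\mathcal D_N$ satisfy $\|P-\mathrm{Id}\|_2\le\delta$. Then there exists a permutation $\tilde P\in\mathcal D_N$ such that: (i) $\|\tilde P-\mathrm{Id}\|_2\le C\delta^{1-\frac\epsilon2}$; (ii) $|\tilde P(\kappa)-\kappa|\le D\delta^\epsilon$ for every $\kappa\in\mathcal R_N$; (iii) there is a discrete flow connecting $P$ to $\tilde P$ of length at most $C'\delta^{1-\epsilon}$.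
   Context: $\mathcal R_N$ is the tiling of $[0,1]^\nu$ by $N^\nu$ closed axis-parallel cubes of side $N^{-1}$; $c(\kappa)$ is the center of a cube $\kappa\in\mathcal R_N$. $\mathcal D_N$ is the group of permutations of $\mathcal R_N$: measure-preserving maps $P:[0,1]^\nu\to[0,1]^\nu$ (up to null sets) which send each cube of $\mathcal R_N$ onto a cube of $\mathcal R_N$ bijectively, by translation: $P(x)=x+c(P(\kappa))-c(\kappa)$ for $x\in\mathrm{int}(\kappa)$. $|P(\kappa)-\kappa|$ denotes $|c(P(\kappa))-c(\kappa)|$ (Euclidean norm). $\|P-Q\|_2$ is the norm of $P-Q$ in $L^2([0,1]^\nu;\mathbb R^\nu)$. A rectangle is a set $\prod_{i=1}^\nu[h_i/N,\tilde h_i/N]$ with integers $0\le h_i<\tilde h_i\le N$; an array $A$ is a rectangle which has side $1/N$ in all coordinate directions but one; its length $\ell(A)$ is the number of cubes of $\mathcal R_N$ it contains, and we write $A=[\kappa_1,\dots,\kappa_{\ell(A)}]$ for its consecutive cubes. Sets are called disjoint if their interiors are disjoint. A sequence of $h$ swapping couples in an array $A=[\kappa_1,\dots,\kappa_{\ell(A)}]$ is given by indices $p_1<p_2<\dots<p_{2h}$, $2h\le\ell(A)$; its couples are $(\kappa_{p_j},\kappa_{p_{2h-j+1}})$, $j=1,\dots,h$ (nested couples). An elementary movement $Z:[0,1]^\nu\to[0,1]^\nu$ is given by pairwise disjoint arrays $A_1,\dots,A_m$ and, for each $i$, a sequence of $h(i)$ swapping couples in $A_i$: $Z$ exchanges by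 translation the two cubes of each couple, and is the identity elsewhere. Its cost is $L(Z)=\max_i\ell(A_i)\,N^{-1-\frac\nu2}\sqrt{\sum_{i=1}^m h(i)}$ (computed from the given arrays and couples). A discrete flow is a finite sequence $\{Z_k\}_{k=1}^T$ of elementary movements; its length is $\sum_{k=1}^T L(Z_k)$; it connects $P$ to $\tilde P$ if $Z_T\circ\cdots\circ Z_1\circ P=\tilde P$. *)

theory Defs
  imports "HOL-Analysis.Analysis"
begin

text \<open>
  The ambient space is \<open>real ^ 'd\<close>, so the dimension is \<open>CARD('d)\<close>. Maps of the unit cube are
  total functions on \<open>real ^ 'd\<close> of which only the values on the unit cube, up to null sets,
  matter.
\<close>

definition unit_cube :: "(real ^ 'd) set" where
  "unit_cube = cbox 0 1"

definition rectangle :: "nat \<Rightarrow> ('d \<Rightarrow> nat) \<Rightarrow> ('d \<Rightarrow> nat) \<Rightarrow> (real ^ 'd) set" where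
  "rectangle N h h' = cbox (\<chi> i. real (h i) / real N) (\<chi> i. real (h' i) / real N)"

definition cubes :: "nat \<Rightarrow> (real ^ 'd) set set" where
  "cubes N = {rectangle N h (\<lambda>i. h i + 1) | h. \<forall>i. h i < N}"

definition center :: "(real ^ 'd) set \<Rightarrow> real ^ 'd" where
  "center K = midpoint (interval_lowerbound K) (interval_upperbound K)"

definition translates_to ::
    "(real ^ 'd \<Rightarrow> real ^ 'd) \<Rightarrow> (real ^ 'd) set \<Rightarrow> (real ^ 'd) set \<Rightarrow> bool" where
  "translates_to P K K' \<longleftrightarrow>
     (AE x in lebesgue_on (interior K). P x = x + center K' - center K)"

text \<open>
  \<open>permutations N\<close> is the group \<open>\<D>\<^sub>N\<close>. That the induced map on \<open>cubes N\<close> is a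
  bijection is a consequence of measure preservation.
\<close>

definition permutations :: "nat \<Rightarrow> (real ^ 'd \<Rightarrow> real ^ 'd) set" where
  "permutations N =
     {P. P \<in> lebesgue_on unit_cube \<rightarrow>\<^sub>M lebesgue_on unit_cube \<and>
         distr (lebesgue_on unit_cube) (lebesgue_on unit_cube) P = lebesgue_on unit_cube \<and>
         (\<forall>K\<in>cubes N. \<exists>K'\<in>cubes N. translates_to P K K')}"

definition image_cube ::
    "nat \<Rightarrow> (real ^ 'd \<Rightarrow> real ^ 'd) \<Rightarrow> (real ^ 'd) set \<Rightarrow> (real ^ 'd) set" where
  "image_cube N P K = (THE K'. K' \<in> cubes N \<and> translates_to P K K')"

definition L2_dist :: "(real ^ 'd \<Rightarrow> real ^ 'd) \<Rightarrow> (real ^ 'd \<Rightarrow> real ^ 'd) \<Rightarrow> real" where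
  "L2_dist P Q = sqrt (LINT x|lebesgue_on unit_cube. (norm (P x - Q x))\<^sup>2)"

definition arrays :: "nat \<Rightarrow> (real ^ 'd) set set" where
  "arrays N = {rectangle N h h' | h h'.
     (\<forall>i. h i < h' i \<and> h' i \<le> N) \<and> (\<exists>j. \<forall>i. i \<noteq> j \<longrightarrow> h' i = h i + 1)}"

definition array_length :: "nat \<Rightarrow> (real ^ 'd) set \<Rightarrow> nat" where
  "array_length N A = card {K \<in> cubes N. K \<subseteq> A}"

text \<open>
  The cubes of an array, listed in increasing order of the coordinate along the array. (Listing
  them in decreasing order would give the same couples of cubes, because couples are nested.)
\<close>

definition array_cubes :: "nat \<Rightarrow> (real ^ 'd) set \<Rightarrow> (real ^ 'd) set list" where
  "array_cubes N A =
     (THE Ks. distinct Ks \<and> set Ks = {K \<in> cubes N. K \<subseteq> A} \<and>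
        (\<exists>j. \<forall>k. Suc k < length Ks \<longrightarrow>
           center (Ks ! Suc k) = center (Ks ! k) + axis j (1 / real N)))"

text \<open>
  The data of an elementary movement is a list of arrays, each paired with its list of indices
  \<open>p\<^sub>1 < \<dots> < p\<^sub>2\<^sub>h\<close>; indices count from 0. The bound \<open>2h \<le> \<ell>(A)\<close> follows from the bound on
  the indices.
\<close>

type_synonym 'd movement = "((real ^ 'd) set \<times> nat list) list"

definition elementary_movement :: "nat \<Rightarrow> 'd::finite movement \<Rightarrow> bool" where
  "elementary_movement N d \<longleftrightarrow>
     d \<noteq> [] \<and>
     (\<forall>(A, p)\<in>set d. A \<in> arrays N \<and> even (length p) \<and> sorted_wrt (<) p \<and>
        (\<forall>k\<in>set p. k < array_length N A)) \<and>
     (\<forall>i<length d. \<forall>j<length d. i \<noteq> j \<longrightarrow>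
        interior (fst (d ! i)) \<inter> interior (fst (d ! j)) = {})"

definition couples :: "nat \<Rightarrow> 'd::finite movement \<Rightarrow> ((real ^ 'd) set \<times> (real ^ 'd) set) set" where
  "couples N d =
     {(array_cubes N A ! (p ! j), array_cubes N A ! (p ! (length p - 1 - j))) | A p j.
        (A, p) \<in> set d \<and> j < length p div 2}"

text \<open>
  The map of an elementary movement; the boundaries of the exchanged cubes, a null set,
  are left fixed.
\<close>

definition movement_map :: "nat \<Rightarrow> 'd::finite movement \<Rightarrow> real ^ 'd \<Rightarrow> real ^ 'd" where
  "movement_map N d x =
     (if \<exists>(K, K')\<in>couples N d \<union> (couples N d)\<inverse>. x \<in> interior K
      then THE y. \<exists>(K, K')\<in>couples N d \<union> (couples N d)\<inverse>.
                    x \<in> interior K \<and> y = x + center K' - center K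
      else x)"

definition movement_cost :: "nat \<Rightarrow> 'd::finite movement \<Rightarrow> real" where
  "movement_cost N d =
     real (MAX (A, p)\<in>set d. array_length N A)
       * real N powr (- 1 - real CARD('d) / 2)
       * sqrt (real (\<Sum>(A, p)\<leftarrow>d. length p div 2))"

definition discrete_flow :: "nat \<Rightarrow> 'd::finite movement list \<Rightarrow> bool" where
  "discrete_flow N ds \<longleftrightarrow> (\<forall>d\<in>set ds. elementary_movement N d)"

definition flow_length :: "nat \<Rightarrow> 'd::finite movement list \<Rightarrow> real" where
  "flow_length N ds = (\<Sum>d\<leftarrow>ds. movement_cost N d)"

text \<open>The first movement of the list is applied first.\<close>

definition connects ::
    "nat \<Rightarrow> 'd::finite movement list \<Rightarrow> (real ^ 'd \<Rightarrow> real ^ 'd) \<Rightarrow> (real ^ 'd \<Rightarrow> real ^ 'd) \<Rightarrow> bool" where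
  "connects N ds P Q \<longleftrightarrow>
     (AE x in lebesgue_on unit_cube. fold (movement_map N) ds (P x) = Q x)"

end

theory Submission
  imports Defs
begin

text \<open>
  Let \<open>s = \<delta>\<^sup>\<epsilon> N\<close> and split the grid into blocks of side \<open>s\<close>, so that there are \<open>M = N / s\<close>
  blocks per direction. Call a cube bad if \<open>P\<close> displaces it by more than one block side. By Chebyshev
  the number \<open>b\<close> of bad cubes is at most \<open>N\<^sup>\<nu>\<close> times \<open>\<delta>\<close> to the power \<open>2 - 2 \<epsilon>\<close>, and the bound on
  \<open>\<epsilon>\<close> makes this at most \<open>s\<^sup>\<nu>\<close>, the number of cubes of one block.

  First the bad cubes are rearranged inside their blocks, one direction at a time, so that no two of
  them have the same offset within a block. This needs \<open>2 \<nu>\<close> movements. Then every bad cube travels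
  to the block of its origin within the sublattice of its own offset, exchanging its place with the
  cube of the same offset in an adjacent block that is closer to the target. Since the distance to the
  target decreases, no block is visited twice, so every other cube is pushed at most once, by one
  block. All bad cubes travel simultaneously, in \<open>O(M)\<close> movements. Each movement uses arrays of length
  at most \<open>2 s\<close> and at most \<open>b\<close> couples, so it costs \<open>O(\<delta>)\<close>, which gives (iii). In total \<open>O(M b)\<close>
  cubes are moved, each by \<open>O(s)\<close>, which gives (i) and (ii).
\<close>

subsection \<open>Cells and arrays of the grid\<close>

text \<open>The cost of a movement grows only like the square root of the number of couples, but
  linearly in the longest array. So transport has to be cut into hops inside arrays of length O(s),
  with all bad cubes moving at once in each hop. As b <= \<delta>^(2 - 2 \<epsilon>) N^\<nu>, a hop
  costs of order (s / N) N^(-\<nu> / 2) sqrt b <= \<delta>^\<epsilon> \<delta>^(1 - \<epsilon>) =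
  \<delta>, and about M = \<delta>^(-\<epsilon>) hops are made. The moved cubes add of order M b (s
  / N)^2 <= \<delta>^(2 - \<epsilon>) N^\<nu> to the sum of squared displacements, hence the
  exponent in (i). Two obstacles stand against moving all bad cubes at once. They must not compete
  for a place: distinct offsets put them into disjoint sublattices, and there are enough offsets
  because the bound on \<epsilon> says \<epsilon> \<nu> <= 2 - 2 \<epsilon>. And nested couples
  reverse the order inside an array, whereas translating several cubes into the next block preserves
  it: hence offsets that are reflected in every other block.\<close>

definition grid :: "nat \<Rightarrow> ('d \<Rightarrow> nat) set" where
  "grid N = {h. \<forall>i. h i < N}"

definition cell :: "nat \<Rightarrow> ('d::finite \<Rightarrow> nat) \<Rightarrow> (real ^ 'd) set" where
  "cell N h = rectangle N h (\<lambda>i. h i + 1)"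

definition grid_shift :: "nat \<Rightarrow> ('d::finite \<Rightarrow> nat) \<Rightarrow> ('d \<Rightarrow> nat) \<Rightarrow> real ^ 'd" where
  "grid_shift N p q = (\<chi> i. (real (q i) - real (p i)) / real N)"

lemma finite_grid [simp]: "finite (grid N :: ('d::finite \<Rightarrow> nat) set)"
proof -
  have "grid N = (UNIV :: 'd set) \<rightarrow>\<^sub>E {..<N}"
    by (auto simp: grid_def PiE_def extensional_def)
  then show ?thesis by (simp add: finite_PiE)
qed

lemma cubes_eq: "cubes N = cell N ` grid N"
  by (auto simp: cubes_def cell_def grid_def)

lemma mem_interior_cell:
  assumes "N > 0"
  shows "x \<in> interior (cell N h) \<longleftrightarrow> (\<forall>i. real (h i) < real N * x $ i \<and> real N * x $ i < real (h i) + 1)"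
  using assms by (auto simp: cell_def rectangle_def interior_cbox mem_box_cart field_simps)

lemma interior_cell_unique:
  assumes "N > 0" "x \<in> interior (cell N p)" "x \<in> interior (cell N q)"
  shows "p = q"
proof
  fix i
  have "real (p i) < real N * x $ i" "real N * x $ i < real (p i) + 1"
    "real (q i) < real N * x $ i" "real N * x $ i < real (q i) + 1"
    using assms by (auto simp: mem_interior_cell)
  then show "p i = q i" by linarith
qed

lemma center_cell:
  assumes "N > 0"
  shows "center (cell N h) = (\<chi> i. (real (h i) + 1 / 2) / real N)"
proof -
  have "cell N h \<noteq> {}" using assms
    by (auto simp: cell_def rectangle_def interval_ne_empty_cart divide_right_mono)
  then show ?thesis
    using assms
    by (simp add: center_def cell_def rectangle_def midpoint_def vec_eq_iff field_simps)
qed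

lemma center_diff:
  assumes "N > 0"
  shows "center (cell N q) - center (cell N p) = grid_shift N p q"
  using assms by (simp add: center_cell grid_shift_def vec_eq_iff field_simps)

lemma center_in_interior:
  assumes "N > 0"
  shows "center (cell N h) \<in> interior (cell N h)"
  using assms by (simp add: mem_interior_cell center_cell)

lemma inj_cell:
  assumes "N > 0"
  shows "inj (cell N)"
  by (rule injI) (metis assms center_in_interior interior_cell_unique)

lemma shift_interior_cell:
  assumes "N > 0" "x \<in> interior (cell N p)"
  shows "x + grid_shift N p q \<in> interior (cell N q)"
proof -
  have e: "real N * (x + grid_shift N p q) $ i = real N * x $ i + (real (q i) - real (p i))" for i
    using assms(1) by (simp add: grid_shift_def distrib_left)
  have b: "real (p i) < real N * x $ i \<and> real N * x $ i < real (p i) + 1" for i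
    using assms by (simp add: mem_interior_cell)
  have "real (q i) < real N * (x + grid_shift N p q) $ i \<and>
      real N * (x + grid_shift N p q) $ i < real (q i) + 1" for i
    using e[of i] b[of i] by linarith
  then show ?thesis unfolding mem_interior_cell[OF assms(1)] by blast
qed

section \<open>Arrays of length \<open>l\<close> in direction \<open>j\<close> and the lists of
  their cells\<close>

definition segment_box :: "nat \<Rightarrow> 'd::finite \<Rightarrow> nat \<Rightarrow> ('d \<Rightarrow> nat) \<Rightarrow> (real ^ 'd) set" where
  "segment_box N j l a = rectangle N a (\<lambda>i. a i + (if i = j then l else 1))"

lemma segment_box_in_arrays:
  assumes "l > 0" "a \<in> grid N" "a j + l \<le> N"
  shows "segment_box N j l a \<in> arrays N"
  unfolding arrays_def segment_box_def mem_Collect_eq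
  using assms by (intro exI[of _ a] exI[of _ "\<lambda>i. a i + (if i = j then l else 1)"])
    (auto simp: grid_def Suc_le_eq)

lemma mem_interior_segment_box:
  assumes "N > 0"
  shows "x \<in> interior (segment_box N j l a) \<longleftrightarrow>
    (\<forall>i. real (a i) < real N * x $ i \<and> real N * x $ i < real (a i) + (if i = j then real l else 1))"
  using assms
  by (auto simp: segment_box_def rectangle_def interior_cbox mem_box_cart field_simps)

lemma cell_subset_rectangle:
  assumes "N > 0"
  shows "cell N h \<subseteq> rectangle N a a' \<longleftrightarrow> (\<forall>i. a i \<le> h i \<and> h i + 1 \<le> a' i)"
proof
  assume L: "cell N h \<subseteq> rectangle N a a'"
  have "(\<chi> i. real (h i) / real N) \<in> rectangle N a a'"
    by (rule subsetD[OF L]) (use assms in \<open>auto simp: cell_def rectangle_def mem_box_cart divide_right_mono\<close>)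
  moreover have "(\<chi> i. real (h i + 1) / real N) \<in> rectangle N a a'"
    by (rule subsetD[OF L]) (use assms in \<open>auto simp: cell_def rectangle_def mem_box_cart divide_right_mono\<close>)
  ultimately show "\<forall>i. a i \<le> h i \<and> h i + 1 \<le> a' i"
    using assms by (auto simp: rectangle_def mem_box_cart divide_le_cancel)
      (smt (verit, best) of_nat_le_iff of_nat_Suc)+
next
  assume "\<forall>i. a i \<le> h i \<and> h i + 1 \<le> a' i"
  then have "real (a i) / real N \<le> real (h i) / real N"
    "real (h i + 1) / real N \<le> real (a' i) / real N" for i
    by (auto intro!: divide_right_mono simp del: of_nat_Suc of_nat_add)
  then show "cell N h \<subseteq> rectangle N a a'"
    unfolding cell_def rectangle_def by (auto simp: mem_box_cart) (meson order_trans)+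
qed

lemma cubes_in_segment_box:
  assumes "N > 0" "a \<in> grid N" "a j + l \<le> N"
  shows "{K \<in> cubes N. K \<subseteq> segment_box N j l a} = (\<lambda>k. cell N (a(j := a j + k))) ` {..<l}"
proof (intro equalityI subsetI)
  fix K assume "K \<in> {K \<in> cubes N. K \<subseteq> segment_box N j l a}"
  then obtain h where h: "K = cell N h" "h \<in> grid N" "cell N h \<subseteq> segment_box N j l a"
    by (auto simp: cubes_eq)
  have *: "a i \<le> h i \<and> h i + 1 \<le> a i + (if i = j then l else 1)" for i
    using h(3) assms(1) by (simp add: segment_box_def cell_subset_rectangle)
  obtain k where k: "h j = a j + k" using *[of j] le_Suc_ex by blast
  have e: "h = a(j := a j + k)"
  proof
    fix i show "h i = (a(j := a j + k)) i"
      using *[of i] k by (cases "i = j") auto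
  qed
  have "k < l" using *[of j] k by auto
  then show "K \<in> (\<lambda>k. cell N (a(j := a j + k))) ` {..<l}"
    unfolding h(1) by (intro image_eqI[where x=k, OF arg_cong[OF e]]) simp
next
  fix K assume "K \<in> (\<lambda>k. cell N (a(j := a j + k))) ` {..<l}"
  then obtain k where k: "k < l" "K = cell N (a(j := a j + k))" by auto
  have "a(j := a j + k) \<in> grid N" using assms k by (auto simp: grid_def)
  moreover have "cell N (a(j := a j + k)) \<subseteq> segment_box N j l a"
    using assms k by (simp add: segment_box_def cell_subset_rectangle)
  ultimately show "K \<in> {K \<in> cubes N. K \<subseteq> segment_box N j l a}"
    using k by (auto simp: cubes_eq)
qed

lemma inj_segment_cells:
  assumes "N > 0"
  shows "inj (\<lambda>k. cell N (a(j := a j + k)))"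
proof (rule injI)
  fix k k' assume "cell N (a(j := a j + k)) = cell N (a(j := a j + k'))"
  then have "a(j := a j + k) = a(j := a j + k')"
    using inj_cell[OF assms] by (auto dest: injD)
  then show "k = k'" by (metis add_left_cancel fun_upd_same)
qed

lemma array_length_segment_box:
  assumes "N > 0" "a \<in> grid N" "a j + l \<le> N"
  shows "array_length N (segment_box N j l a) = l"
  unfolding array_length_def cubes_in_segment_box[OF assms]
  using card_image[OF inj_on_subset[OF inj_segment_cells[OF assms(1)] subset_UNIV]]
  by (metis card_lessThan)

text \<open>\<open>array_cubes\<close> is a definite description whose direction is existentially
  quantified, so the work is uniqueness: every step of a second admissible list must also be along
  \<open>j\<close>, hence both lists are strictly sorted by the \<open>j\<close>-th coordinate of
  the centers and have the same members.\<close>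

lemma array_cubes_segment_box:
  assumes N: "N > 0" and a: "a \<in> grid N" "a j + l \<le> N"
  shows "array_cubes N (segment_box N j l a) = map (\<lambda>k. cell N (a(j := a j + k))) [0..<l]"
proof -
  let ?f = "\<lambda>k. cell N (a(j := a j + k))"
  let ?P = "\<lambda>Ks. distinct Ks \<and> set Ks = ?f ` {..<l} \<and>
        (\<exists>j. \<forall>k. Suc k < length Ks \<longrightarrow>
           center (Ks ! Suc k) = center (Ks ! k) + axis j (1 / real N))"
  have cf: "center (?f k) $ i = (real (a i) + (if i = j then real k else 0) + 1/2) / real N" for k i
    using N by (simp add: center_cell)
  have ex: "?P (map ?f [0..<l])"
  proof (intro conjI)
    show "distinct (map ?f [0..<l])"
      using inj_segment_cells[OF N, of a j]
      by (auto simp: distinct_map intro: inj_on_subset)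
    show "set (map ?f [0..<l]) = ?f ` {..<l}" by auto
    have "center (?f (Suc k)) = center (?f k) + axis j (1 / real N)" for k
    proof (rule vec_eq_iff[THEN iffD2], rule allI)
      fix i show "center (?f (Suc k)) $ i = (center (?f k) + axis j (1 / real N)) $ i"
        unfolding vector_add_component cf
        using N by (cases "i = j") (simp_all add: axis_def field_simps)
    qed
    then show "\<exists>j. \<forall>k. Suc k < length (map ?f [0..<l]) \<longrightarrow>
       center ((map ?f [0..<l]) ! Suc k) = center ((map ?f [0..<l]) ! k) + axis j (1 / real N)"
      by (intro exI[of _ j]) simp
  qed
  have uniq: "Ks = map ?f [0..<l]" if P: "?P Ks" for Ks
  proof -
    obtain j' where j': "\<And>k. Suc k < length Ks \<Longrightarrow>
        center (Ks ! Suc k) = center (Ks ! k) + axis j' (1 / real N)" using P by auto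
    have mem: "\<exists>k<l. Ks ! i = ?f k" if "i < length Ks" for i
    proof -
      have "Ks ! i \<in> ?f ` {..<l}" using P that nth_mem[OF that] by metis
      then show ?thesis by (auto simp del: fun_upd_apply)
    qed
    have "sorted_wrt (\<lambda>K K'. center K $ j < center K' $ j) Ks"
    proof (rule iffD2[OF sorted_wrt_iff_nth_Suc_transp])
      show "transp (\<lambda>K K'. center K $ j < center K' $ j)" by (auto intro: transpI)
      show "\<forall>i. Suc i < length Ks \<longrightarrow> center (Ks ! i) $ j < center (Ks ! Suc i) $ j"
      proof (intro allI impI)
        fix i assume i: "Suc i < length Ks"
        then obtain k k' where kk: "Ks ! i = ?f k" "Ks ! Suc i = ?f k'" using mem[OF i] mem[OF Suc_lessD[OF i]] by (elim exE conjE) blast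
        have "center (?f k') $ j' = center (?f k) $ j' + 1 / real N"
          using arg_cong[OF j'[OF i], of "\<lambda>v. v $ j'"] unfolding kk by (simp only: vector_add_component axis_nth)
        \<comment> \<open>Cells of the segment differ in coordinate \<open>j\<close> only, so a step
          of \<open>1 / N\<close> in any other direction is impossible.\<close>
        then have "j' = j" unfolding cf using N by (cases "j' = j") simp_all
        then show "center (Ks ! i) $ j < center (Ks ! Suc i) $ j"
          using arg_cong[OF j'[OF i], of "\<lambda>v. v $ j"] N by (simp only: vector_add_component axis_nth) simp
      qed
    qed
    moreover have "sorted_wrt (\<lambda>K K'. center K $ j < center K' $ j) (map ?f [0..<l])"
      unfolding sorted_wrt_iff_nth_less using N
      by (simp add: cf divide_strict_right_mono)
    moreover have st: "set Ks = set (map ?f [0..<l])" using P ex by metis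
    ultimately have "map (\<lambda>K. center K $ j) Ks = map (\<lambda>K. center K $ j) (map ?f [0..<l])"
      by (intro strict_sorted_equal) (simp_all only: sorted_wrt_map set_map)
    moreover have "inj_on (\<lambda>K. center K $ j) (set Ks \<union> set (map ?f [0..<l]))"
      using N by (auto simp: st inj_on_def cf simp del: fun_upd_apply)
    ultimately show ?thesis using inj_on_map_eq_map by blast
  qed
  show ?thesis
    unfolding array_cubes_def cubes_in_segment_box[OF assms]
    by (rule the_equality[where P="?P"], rule ex, erule uniq)
qed

subsection \<open>Reachable permutations of the grid\<close>

text \<open>The images of the increasing list of \<open>U\<close> form a strictly decreasing list
  with the same members, so its reverse is the original list. An order-reversing self-map is thus
  the pairing of nested couples, and in particular an involution.\<close>

lemma antimono_on_sorted_list: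
  fixes U :: "nat set"
  assumes U: "finite U" and f: "\<And>x. x \<in> U \<Longrightarrow> f x \<in> U"
    and anti: "\<And>x y. \<lbrakk>x \<in> U; y \<in> U; x < y\<rbrakk> \<Longrightarrow> f y < f x"
    and i: "i < card U"
  shows "f (sorted_list_of_set U ! i) = sorted_list_of_set U ! (card U - 1 - i)"
proof -
  let ?p = "sorted_list_of_set U"
  have p: "sorted_wrt (<) ?p" "set ?p = U" "length ?p = card U"
    using U by auto
  have inj: "inj_on f U"
    by (rule inj_onI) (metis anti less_irrefl linorder_neqE_nat)
  have s: "sorted_wrt (<) (rev (map f ?p))"
    unfolding sorted_wrt_rev sorted_wrt_map
    by (rule sorted_wrt_mono_rel[OF _ p(1)]) (use anti p(2) in auto)
  have "set (rev (map f ?p)) = set ?p"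
    using p(2) f by (simp add: endo_inj_surj[OF U _ inj] image_subsetI)
  then have "rev (map f ?p) = ?p"
    using strict_sorted_equal[OF p(1) s] by simp
  then have "rev (map f ?p) ! (card U - 1 - i) = ?p ! (card U - 1 - i)" by simp
  then show ?thesis using i p(3) by (simp add: rev_nth)
qed

text \<open>In a set of odd size the middle element would be paired with itself.\<close>

lemma antimono_on_even_card:
  fixes U :: "nat set"
  assumes U: "finite U" and f: "\<And>x. x \<in> U \<Longrightarrow> f x \<in> U"
    and anti: "\<And>x y. \<lbrakk>x \<in> U; y \<in> U; x < y\<rbrakk> \<Longrightarrow> f y < f x"
    and nofix: "\<And>x. x \<in> U \<Longrightarrow> f x \<noteq> x"
  shows "even (card U)"
proof (rule ccontr)
  assume "odd (card U)"
  then obtain h where h: "card U = 2 * h + 1" by (elim oddE)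
  then have "f (sorted_list_of_set U ! h) = sorted_list_of_set U ! h"
    using antimono_on_sorted_list[where U=U and f=f and i=h] U f anti by simp
  moreover have "sorted_list_of_set U ! h \<in> U"
    using nth_mem[of h "sorted_list_of_set U"] h U by simp
  ultimately show False using nofix by blast
qed

text \<open>Required at every point of the open cells, not just almost everywhere, so that flows
  compose without an argument about null sets.\<close>

definition flow_maps :: "nat \<Rightarrow> 'd::finite movement list \<Rightarrow> (('d \<Rightarrow> nat) \<Rightarrow> ('d \<Rightarrow> nat)) \<Rightarrow> bool" where
  "flow_maps N ds z \<longleftrightarrow> (\<forall>p\<in>grid N. \<forall>x\<in>interior (cell N p).
     fold (movement_map N) ds x = x + grid_shift N p (z p))"

text \<open>\<open>c\<close> bounds the length of a flow that realizes \<open>z\<close>, and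
  \<open>k\<close> the number of cells moved. Both add up under composition; the first leads to
  (iii), the second to (i).\<close>

definition reachable :: "nat \<Rightarrow> real \<Rightarrow> nat \<Rightarrow> (('d::finite \<Rightarrow> nat) \<Rightarrow> ('d \<Rightarrow> nat)) \<Rightarrow> bool" where
  "reachable N c k z \<longleftrightarrow>
     bij_betw z (grid N) (grid N) \<and> card {p \<in> grid N. z p \<noteq> p} \<le> k \<and>
     (\<exists>ds. discrete_flow N ds \<and> flow_length N ds \<le> c \<and> flow_maps N ds z)"

lemma reachable_id: "reachable N 0 0 (\<lambda>p. p)"
  unfolding reachable_def
proof (intro conjI exI[of _ "[]"])
  show "bij_betw (\<lambda>p. p) (grid N) (grid N)" by (auto simp: bij_betw_def)
qed (auto simp: discrete_flow_def flow_length_def flow_maps_def grid_shift_def vec_eq_iff)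

lemma reachable_mono:
  assumes "reachable N c k z" "c \<le> c'" "k \<le> k'"
  shows "reachable N c' k' z"
  using assms unfolding reachable_def by (meson order_trans)

lemma reachable_comp:
  fixes z z' :: "('d::finite \<Rightarrow> nat) \<Rightarrow> 'd \<Rightarrow> nat"
  assumes N: "N > 0" and 1: "reachable N c k z" and 2: "reachable N c' k' z'"
  shows "reachable N (c + c') (k + k') (\<lambda>p. z' (z p))"
proof -
  obtain ds where ds: "discrete_flow N ds" "flow_length N ds \<le> c" "flow_maps N ds z"
    using 1 by (auto simp: reachable_def)
  obtain ds' where ds': "discrete_flow N ds'" "flow_length N ds' \<le> c'" "flow_maps N ds' z'"
    using 2 by (auto simp: reachable_def)
  have b: "bij_betw z (grid N) (grid N)" "bij_betw z' (grid N) (grid N)"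
    using 1 2 by (auto simp: reachable_def)
  have "flow_maps N (ds @ ds') (\<lambda>p. z' (z p))"
    unfolding flow_maps_def
  proof (intro ballI)
    fix p :: "'d \<Rightarrow> nat" and x assume px: "p \<in> grid N" "x \<in> interior (cell N p)"
    have "z p \<in> grid N" using b px by (auto simp: bij_betw_def)
    then have "fold (movement_map N) (ds @ ds') x
        = x + grid_shift N p (z p) + grid_shift N (z p) (z' (z p))"
      using ds(3) ds'(3) px shift_interior_cell[OF N px(2)] by (simp add: flow_maps_def)
    also have "\<dots> = x + grid_shift N p (z' (z p))"
      by (simp add: grid_shift_def vec_eq_iff diff_divide_distrib)
    finally show "fold (movement_map N) (ds @ ds') x = x + grid_shift N p (z' (z p))" .
  qed
  moreover have "discrete_flow N (ds @ ds')" using ds ds' by (auto simp: discrete_flow_def)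
  moreover have "flow_length N (ds @ ds') \<le> c + c'" using ds ds' by (auto simp: flow_length_def)
  moreover have "bij_betw (\<lambda>p. z' (z p)) (grid N) (grid N)"
    using bij_betw_trans[OF b] by (simp add: comp_def)
  moreover have "card {p \<in> grid N. z' (z p) \<noteq> p} \<le> k + k'"
  proof -
    have "{p \<in> grid N. z' (z p) \<noteq> p} \<subseteq> {p \<in> grid N. z p \<noteq> p} \<union> {p \<in> grid N. z' p \<noteq> p}"
      by auto
    then have "card {p \<in> grid N. z' (z p) \<noteq> p}
        \<le> card ({p \<in> grid N. z p \<noteq> p} \<union> {p \<in> grid N. z' p \<noteq> p})"
      by (intro card_mono) auto
    also have "\<dots> \<le> card {p \<in> grid N. z p \<noteq> p} + card {p \<in> grid N. z' p \<noteq> p}"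
      by (rule card_Un_le)
    also have "\<dots> \<le> k + k'" using 1 2 by (auto simp: reachable_def)
    finally show ?thesis .
  qed
  ultimately show ?thesis unfolding reachable_def by blast
qed

text \<open>The only source of elementary movements. Direction \<open>j\<close> is cut into segments
  of \<open>l\<close> cells starting at \<open>r\<close>; a map of \<open>W\<close> that stays in
  the segments, reverses the order in each and has no fixed point is a family of nested couples,
  hence a single movement with \<open>card W / 2\<close> couples. The starting point
  \<open>r\<close> allows staggered tilings by segments.\<close>

lemma reachable_reversal:
  fixes W :: "('d::finite \<Rightarrow> nat) set" and z :: "('d \<Rightarrow> nat) \<Rightarrow> 'd \<Rightarrow> nat"
  assumes N: "N > 0" and l: "l > 0" and W: "W \<subseteq> grid N"
    and fit': "\<forall>p\<in>W. r \<le> p j \<and> r + ((p j - r) div l + 1) * l \<le> N"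
    and z: "\<forall>p\<in>W. z p \<in> W \<and> z p \<noteq> p \<and> (\<forall>i. i \<noteq> j \<longrightarrow> z p i = p i) \<and>
       (z p j - r) div l = (p j - r) div l"
    and anti': "\<forall>p\<in>W. \<forall>q\<in>W. (\<forall>i. i \<noteq> j \<longrightarrow> q i = p i) \<and>
       (q j - r) div l = (p j - r) div l \<and> p j < q j \<longrightarrow> z q j < z p j"
    and id': "\<forall>p. p \<notin> W \<longrightarrow> z p = p"
  shows "reachable N (real l * real N powr (- 1 - real CARD('d) / 2) * sqrt (card W / 2)) (card W) z"
proof (cases "W = {}")
  \<comment> \<open>An elementary movement must contain an array, so for empty \<open>W\<close> the
    empty flow is used.\<close>
  case True
  then have "z = (\<lambda>p. p)" using id' by blast
  then show ?thesis using reachable_id True by simp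
next
  case False
  have fit: "r \<le> p j \<and> r + ((p j - r) div l + 1) * l \<le> N" if "p \<in> W" for p
    using fit' that by blast
  have zW: "z p \<in> W" and nofix: "z p \<noteq> p" and seg: "i \<noteq> j \<Longrightarrow> z p i = p i"
    "(z p j - r) div l = (p j - r) div l" if "p \<in> W" for p i
    using z that by auto
  have anti: "z q j < z p j" if "p \<in> W" "q \<in> W" "\<forall>i. i \<noteq> j \<longrightarrow> q i = p i"
    "(q j - r) div l = (p j - r) div l" "p j < q j" for p q using anti' that by blast
  have id: "z p = p" if "p \<notin> W" for p using id' that by blast
  have finW: "finite W" using W finite_grid by (rule finite_subset)
  \<comment> \<open>Local coordinates: a segment is named by its first cell \<open>a\<close> and a
    cell in it by its position \<open>k\<close>, so that \<open>z\<close> turns into the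
    order-reversing self-maps \<open>f a\<close> of the position sets \<open>U a\<close>.\<close>
  define base where "base p = p(j := r + ((p j - r) div l) * l)" for p :: "'d \<Rightarrow> nat"
  define pt where "pt a k = a(j := a j + k)" for a :: "'d \<Rightarrow> nat" and k
  define U where "U a = {k. k < l \<and> pt a k \<in> W}" for a
  have finU: "finite (U a)" for a by (simp add: U_def)
  define S where "S = base ` W"
  have Sj: "\<exists>u. a j = r + u * l" if "a \<in> S" for a using that by (auto simp: S_def base_def)
  have Sgrid: "a \<in> grid N" "a j + l \<le> N" if a: "a \<in> S" for a
  proof -
    obtain p where p: "p \<in> W" "a = base p" using a by (auto simp: S_def)
    then show "a \<in> grid N" using W fit[OF p(1)] l by (auto simp: base_def grid_def)
    show "a j + l \<le> N" using fit[OF p(1)] by (simp add: p base_def)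
  qed
  have base_pt: "base (pt a k) = a" if "a \<in> S" "k < l" for a k
    using Sj[OF that(1)] that(2) by (auto simp: base_def pt_def)
  have pt_base: "\<exists>k. k \<in> U (base p) \<and> p = pt (base p) k" if "p \<in> W" for p
  proof (intro exI conjI)
    have "p = pt (base p) ((p j - r) mod l)"
      using fit[OF that] by (auto simp: pt_def base_def)
    then show "(p j - r) mod l \<in> U (base p)" "p = pt (base p) ((p j - r) mod l)"
      using that l by (auto simp: U_def)
  qed
  define f where "f a k = z (pt a k) j - a j" for a k
  have f: "z (pt a k) = pt a (f a k)" "f a k \<in> U a" "f a k \<noteq> k" if a: "a \<in> S" and k: "k \<in> U a" for a k
  proof -
    have kW: "pt a k \<in> W" "k < l" using k by (auto simp: U_def)
    have "base (z (pt a k)) = base (pt a k)"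
      using seg[OF kW(1)] by (auto simp: base_def)
    then have b: "base (z (pt a k)) = a" using base_pt[OF a kW(2)] by simp
    then obtain k' where k': "k' \<in> U a" "z (pt a k) = pt a k'"
      using pt_base[OF zW[OF kW(1)]] by auto
    then have "f a k = k'" by (simp add: f_def pt_def)
    then show "z (pt a k) = pt a (f a k)" "f a k \<in> U a" "f a k \<noteq> k"
      using k' nofix[OF kW(1)] by auto
  qed
  have fanti: "f a k' < f a k" if a: "a \<in> S" and k: "k \<in> U a" "k' \<in> U a" "k < k'" for a k k'
  proof -
    have kW: "pt a k \<in> W" "k < l" "pt a k' \<in> W" "k' < l" using k by (auto simp: U_def)
    have "z (pt a k') j < z (pt a k) j"
    proof (rule anti[OF kW(1,3)])
      show "(pt a k' j - r) div l = (pt a k j - r) div l"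
        using base_pt[OF a kW(2)] base_pt[OF a kW(4)] l
        by (metis add_left_cancel base_def fun_upd_same mult_right_cancel less_numeral_extra(3))
    qed (use k in \<open>auto simp: pt_def\<close>)
    then show ?thesis using f(1)[OF a k(1)] f(1)[OF a k(2)] by (simp add: pt_def)
  qed
  define L where "L a = sorted_list_of_set (U a)" for a
  have L: "length (L a) = card (U a)" "set (L a) = U a" "sorted_wrt (<) (L a)" for a
    using finU by (auto simp: L_def)
  have Lrev: "f a (L a ! i) = L a ! (length (L a) - 1 - i)" if "a \<in> S" "i < length (L a)" for a i
    using antimono_on_sorted_list[of "U a" "f a" i] finU f(2)[OF that(1)] fanti[OF that(1)] that(2)
    by (simp add: L_def)
  have Leven: "even (length (L a))" if "a \<in> S" for a
    using antimono_on_even_card[of "U a" "f a"] finU f(2,3)[OF that] fanti[OF that] by (simp add: L)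
  have finS: "finite S" using finW by (simp add: S_def)
  obtain as where as: "set as = S" "distinct as" using finite_distinct_list[OF finS] by blast
  define d where "d = map (\<lambda>a. (segment_box N j l a, L a)) as"
  have alen: "array_length N (segment_box N j l a) = l" if "a \<in> S" for a
    using array_length_segment_box[OF N Sgrid[OF that]] .
  have disj: "interior (segment_box N j l a) \<inter> interior (segment_box N j l a') = {}"
    if S: "a \<in> S" "a' \<in> S" "a \<noteq> a'" for a a'
  proof (rule ccontr)
    assume "interior (segment_box N j l a) \<inter> interior (segment_box N j l a') \<noteq> {}"
    then obtain x where x: "x \<in> interior (segment_box N j l a)" "x \<in> interior (segment_box N j l a')"
      by blast
    have ineq: "real (a i) < real (a' i) + (if i = j then real l else 1)"
       "real (a' i) < real (a i) + (if i = j then real l else 1)" for i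
      using x unfolding mem_interior_segment_box[OF N] by (meson less_trans)+
    have "a i = a' i" for i
    proof (cases "i = j")
      case False then show ?thesis using ineq[of i] by auto
    next
      case True
      \<comment> \<open>Both starting points are \<open>r\<close> plus a multiple of
        \<open>l\<close>, so overlapping intervals of length \<open>l\<close> coincide.\<close>
      obtain u u' where u: "a j = r + u * l" "a' j = r + u' * l" using Sj S by meson
      have lt: "a j < a' j + l" "a' j < a j + l" using ineq[of j] by (simp_all add: of_nat_less_iff[symmetric] del: of_nat_less_iff)
      have "u * l < (u' + 1) * l" "u' * l < (u + 1) * l" using lt u by (simp_all add: algebra_simps)
      then have "u < u' + 1" "u' < u + 1" by (simp_all only: mult_less_cancel2)
      then have "u = u'" by simp
      then show ?thesis using u True by simp
    qed
    then show False using S(3) by blast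
  qed
  have elem: "elementary_movement N d"
    unfolding elementary_movement_def
  proof (intro conjI allI impI ballI)
    show "d \<noteq> []" using False as by (auto simp: d_def S_def)
    fix Ap assume "Ap \<in> set d"
    then obtain a where a: "a \<in> S" "Ap = (segment_box N j l a, L a)" by (auto simp: d_def as)
    have "k < l" if "k \<in> set (L a)" for k using that by (simp add: L U_def)
    then show "case Ap of (A, p) \<Rightarrow> A \<in> arrays N \<and> even (length p) \<and> sorted_wrt (<) p \<and>
        (\<forall>k\<in>set p. k < array_length N A)"
      using a segment_box_in_arrays[OF l Sgrid[OF a(1)]] Leven[OF a(1)] L(3) alen[OF a(1)] by simp
  next
    fix i k assume "i < length d" "k < length d" "i \<noteq> k"
    then have "as ! i \<in> S" "as ! k \<in> S" "as ! i \<noteq> as ! k" "i < length as" "k < length as"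
      using as(2) by (simp_all add: d_def nth_eq_iff_index_eq as(1)[symmetric])
    then show "interior (fst (d ! i)) \<inter> interior (fst (d ! k)) = {}"
      using disj by (simp add: d_def)
  qed
  \<comment> \<open>A couple is listed once, with the lower position first; adding the converse
    relation gives exactly the graph of \<open>z\<close> on \<open>W\<close>.\<close>
  have cpl: "(K, K') \<in> couples N d \<union> (couples N d)\<inverse> \<longleftrightarrow> (\<exists>q\<in>W. K = cell N q \<and> K' = cell N (z q))"
    for K K'
  proof -
    have nthc: "array_cubes N (segment_box N j l a) ! (L a ! i) = cell N (pt a (L a ! i))"
      if "a \<in> S" "i < length (L a)" for a i
    proof -
      have "L a ! i < l" using nth_mem[OF that(2)] by (simp add: L U_def)
      then show ?thesis
        unfolding array_cubes_segment_box[OF N Sgrid[OF that(1)]] by (simp add: pt_def)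
    qed
    have zc: "z (pt a (L a ! i)) = pt a (L a ! (length (L a) - 1 - i))"
      if "a \<in> S" "i < length (L a)" for a i
      using f(1)[OF that(1)] Lrev[OF that] nth_mem[OF that(2)] by (simp add: L)
    have inW: "pt a (L a ! i) \<in> W" if "i < length (L a)" for a i
      using nth_mem[OF that] by (simp add: L U_def)
    have C: "(K, K') \<in> couples N d \<longleftrightarrow> (\<exists>a\<in>S. \<exists>i<length (L a) div 2.
        K = cell N (pt a (L a ! i)) \<and> K' = cell N (pt a (L a ! (length (L a) - 1 - i))))" for K K'
    proof -
      have "(K, K') \<in> couples N d \<longleftrightarrow> (\<exists>a\<in>S. \<exists>i<length (L a) div 2.
        K = array_cubes N (segment_box N j l a) ! (L a ! i) \<and>
        K' = array_cubes N (segment_box N j l a) ! (L a ! (length (L a) - 1 - i)))"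
        unfolding couples_def d_def as(1)[symmetric] by auto
      also have "\<dots> \<longleftrightarrow> (\<exists>a\<in>S. \<exists>i<length (L a) div 2.
        K = cell N (pt a (L a ! i)) \<and> K' = cell N (pt a (L a ! (length (L a) - 1 - i))))"
        by (intro bex_cong refl conj_cong ex_cong1) (auto simp: nthc)
      finally show ?thesis .
    qed
    show ?thesis
    proof
      assume "(K, K') \<in> couples N d \<union> (couples N d)\<inverse>"
      then show "\<exists>q\<in>W. K = cell N q \<and> K' = cell N (z q)"
      proof
        assume "(K, K') \<in> couples N d"
        then obtain a i where ai: "a \<in> S" "i < length (L a) div 2"
          "K = cell N (pt a (L a ! i))" "K' = cell N (pt a (L a ! (length (L a) - 1 - i)))"
          using C by blast
        then have i: "i < length (L a)" by linarith
        have "K' = cell N (z (pt a (L a ! i)))" unfolding zc[OF ai(1) i] by (fact ai(4))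
        then show ?thesis using ai(3) inW[OF i] by blast
      next
        assume "(K, K') \<in> (couples N d)\<inverse>"
        then have "(K', K) \<in> couples N d" by simp
        then obtain a i where ai: "a \<in> S" "i < length (L a) div 2"
          "K' = cell N (pt a (L a ! i))" "K = cell N (pt a (L a ! (length (L a) - 1 - i)))"
          using C by blast
        then have i: "i < length (L a)" "length (L a) - 1 - i < length (L a)"
          "length (L a) - 1 - (length (L a) - 1 - i) = i" by linarith+
        have "K' = cell N (z (pt a (L a ! (length (L a) - 1 - i))))"
          unfolding zc[OF ai(1) i(2)] i(3) by (fact ai(3))
        then show ?thesis using ai(4) inW[OF i(2)] by blast
      qed
    next
      assume "\<exists>q\<in>W. K = cell N q \<and> K' = cell N (z q)"
      then obtain q where q: "q \<in> W" "K = cell N q" "K' = cell N (z q)" by blast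
      define a where "a = base q"
      have a: "a \<in> S" using q by (simp add: a_def S_def)
      obtain k where k: "k \<in> U a" "q = pt a k" using pt_base[OF q(1)] unfolding a_def by blast
      obtain i where i: "i < length (L a)" "k = L a ! i"
        using k(1) unfolding L(2)[of a, symmetric] in_set_conv_nth by blast
      have K: "K = cell N (pt a (L a ! i))" "K' = cell N (pt a (L a ! (length (L a) - 1 - i)))"
        unfolding q(2,3) k(2) i(2) zc[OF a i(1)] by (rule refl)+
      show "(K, K') \<in> couples N d \<union> (couples N d)\<inverse>"
      proof (cases "i < length (L a) div 2")
        case True
        then have "(K, K') \<in> couples N d" using C K a by blast
        then show ?thesis by blast
      next
        case False
        \<comment> \<open>A cell in the second half of the list belongs to the couple listed under
          the mirrored index; since the length is even there is no middle index.\<close>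
        define i' where "i' = length (L a) - 1 - i"
        obtain h where h: "length (L a) = 2 * h" using Leven[OF a] by (elim evenE)
        have i': "i' < length (L a) div 2" "length (L a) - 1 - i' = i"
          using False i(1) unfolding i'_def h by auto
        have "i' < length (L a) div 2 \<and> K' = cell N (pt a (L a ! i')) \<and>
            K = cell N (pt a (L a ! (length (L a) - 1 - i')))"
          unfolding i'(2) using i'(1) K by (simp only: i'_def)
        then have "(K', K) \<in> couples N d"
          unfolding C using a by blast
        then show ?thesis by blast
      qed
    qed
  qed
  have map: "movement_map N d x = x + grid_shift N p (z p)" if px: "x \<in> interior (cell N p)" for p x
  proof -
    let ?C = "couples N d \<union> (couples N d)\<inverse>"
    \<comment> \<open>Stated for every \<open>Q\<close> because \<open>movement_map\<close> uses
      this shape twice, in its condition and in its definite description.\<close>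
    have ex: "(\<exists>(K, K')\<in>?C. x \<in> interior K \<and> Q K K') \<longleftrightarrow> p \<in> W \<and> Q (cell N p) (cell N (z p))" for Q
    proof -
      have "(\<exists>(K, K')\<in>?C. x \<in> interior K \<and> Q K K')
        \<longleftrightarrow> (\<exists>K K'. (K, K') \<in> ?C \<and> x \<in> interior K \<and> Q K K')" by blast
      also have "\<dots> \<longleftrightarrow> (\<exists>q\<in>W. x \<in> interior (cell N q) \<and> Q (cell N q) (cell N (z q)))"
        unfolding cpl by blast
      also have "\<dots> \<longleftrightarrow> p \<in> W \<and> Q (cell N p) (cell N (z p))"
        using px interior_cell_unique[OF N px] by blast
      finally show ?thesis .
    qed
    show ?thesis
    proof (cases "p \<in> W")
      case True
      have "movement_map N d x = x + center (cell N (z p)) - center (cell N p)"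
        unfolding movement_map_def using ex[of "\<lambda>_ _. True"] True ex by simp
      then show ?thesis using center_diff[OF N, of "z p" p] by (simp add: algebra_simps)
    next
      case False
      then have "movement_map N d x = x"
        unfolding movement_map_def using ex[of "\<lambda>_ _. True"] by simp
      then show ?thesis using id[OF False] by (simp add: grid_shift_def vec_eq_iff)
    qed
  qed
  have inj: "inj_on z (grid N)"
  proof (rule inj_onI)
    fix p q assume pq: "z p = z q"
    have W': "p \<in> W \<longleftrightarrow> q \<in> W" using pq id zW by metis
    show "p = q"
    proof (cases "p \<in> W")
      case True
      then have qW: "q \<in> W" using W' by simp
      have off: "q i = p i" if "i \<noteq> j" for i using seg(1)[OF True that] seg(1)[OF qW that] pq by simp
      have dv: "(q j - r) div l = (p j - r) div l" using seg(2)[OF True] seg(2)[OF qW] pq by simp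
      have off': "\<forall>i. i \<noteq> j \<longrightarrow> q i = p i" "\<forall>i. i \<noteq> j \<longrightarrow> p i = q i" using off by auto
      have "\<not> p j < q j" using anti[OF True qW off'(1) dv] pq by force
      moreover have "\<not> q j < p j" using anti[OF qW True off'(2) dv[symmetric]] pq by force
      ultimately have "q j = p j" by simp
      then have "q i = p i" for i using off by (cases "i = j") simp_all
      then show ?thesis by (simp add: fun_eq_iff)
    next
      case False then show ?thesis using W' id pq by metis
    qed
  qed
  have "z p \<in> grid N" if "p \<in> grid N" for p
    using zW[of p] id[of p] W that by (cases "p \<in> W") auto
  then have "z ` grid N \<subseteq> grid N" by blast
  then have bij: "bij_betw z (grid N) (grid N)"
    using endo_inj_surj[OF finite_grid _ inj] inj by (simp add: bij_betw_def)
  have cardW: "(\<Sum>a\<in>S. card (U a)) = card W"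
  proof -
    have "card W = (\<Sum>a\<in>S. card {p \<in> W. base p = a})"
      using sum.image_gen[OF finW, of "\<lambda>_. 1::nat" base] by (simp add: S_def)
    also have "\<dots> = (\<Sum>a\<in>S. card (U a))"
    proof (rule sum.cong[OF refl])
      fix a assume a: "a \<in> S"
      have "{p \<in> W. base p = a} = pt a ` U a"
        using pt_base base_pt[OF a] by (auto simp: U_def)
      moreover have "inj_on (pt a) (U a)"
        by (rule inj_onI) (metis add_left_cancel pt_def fun_upd_same)
      ultimately show "card {p \<in> W. base p = a} = card (U a)" by (simp add: card_image)
    qed
    finally show ?thesis by simp
  qed
  have "(\<Sum>(A, p)\<leftarrow>d. length p div 2) = (\<Sum>a\<in>S. card (U a) div 2)"
    using as by (simp add: d_def comp_def L sum_list_distinct_conv_sum_set)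
  moreover have "2 * (\<Sum>a\<in>S. card (U a) div 2) = (\<Sum>a\<in>S. card (U a))"
    unfolding sum_distrib_left using Leven by (intro sum.cong) (auto simp: L)
  ultimately have h: "2 * (\<Sum>(A, p)\<leftarrow>d. length p div 2) = card W" using cardW by simp
  have "(\<lambda>(A, p). array_length N A) ` set d = {l}"
    using alen False by (force simp: d_def as S_def)
  then have mx: "(MAX (A, p)\<in>set d. array_length N A) = l" by simp
  have "real (\<Sum>(A, p)\<leftarrow>d. length p div 2) = card W / 2" using h by linarith
  then have cost: "movement_cost N d =
      real l * real N powr (- 1 - real CARD('d) / 2) * sqrt (card W / 2)"
    unfolding movement_cost_def mx by simp
  have "{p \<in> grid N. z p \<noteq> p} \<subseteq> W" using id by blast
  then have "card {p \<in> grid N. z p \<noteq> p} \<le> card W" by (rule card_mono[OF finW])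
  then show ?thesis unfolding reachable_def
    using bij elem map cost
    by (intro conjI exI[of _ "[d]"]) (auto simp: discrete_flow_def flow_length_def flow_maps_def)
qed

subsection \<open>Rearranging points inside the segments of blocks\<close>

text \<open>\<open>A\<close> has as many points beyond the initial interval of length
  \<open>card A\<close> as that interval has vacancies, and every vacancy lies below all those
  points. Reversing the increasing list of \<open>L \<union> H\<close> therefore swaps its two
  halves: one order-reversing map packs \<open>A\<close> to the bottom.\<close>

lemma strict_antimono_exchange:
  fixes A :: "nat set"
  assumes "finite A"
  defines "L \<equiv> {..<card A} - A" and "H \<equiv> A - {..<card A}"
  shows "\<exists>f. f ` L = H \<and> f ` H = L \<and> (\<forall>x\<in>L \<union> H. \<forall>y\<in>L \<union> H. x < y \<longrightarrow> f y < f x)"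
proof -
  define n where "n = card L"
  have fin: "finite L" "finite H" using assms by auto
  have "card H + card (A \<inter> {..<card A}) = card L + card (A \<inter> {..<card A})"
    using card_Diff_subset_Int[of A "{..<card A}"] card_Diff_subset_Int[of "{..<card A}" A] assms(1)
    by (metis L_def H_def Int_commute card_Int_Diff card_lessThan finite_lessThan add.commute)
  then have cH: "card H = n" by (simp add: n_def)
  obtain hL where hL: "bij_betw hL {..<n} L" "strict_mono_on {..<n} hL"
    using ex_bij_betw_strict_mono_card[OF fin(1)] n_def by metis
  obtain hH where hH: "bij_betw hH {..<n} H" "strict_mono_on {..<n} hH"
    using ex_bij_betw_strict_mono_card[OF fin(2)] cH by metis
  define g where "g i = (if i < n then hL i else hH (i - n))" for i
  have gL: "g ` {..<n} = L" using hL(1) by (auto simp: bij_betw_def g_def)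
  have gH: "g ` {n..<2 * n} = H"
  proof -
    have "{n..<2 * n} = (\<lambda>i. i + n) ` {..<n}"
      using image_add_atLeastLessThan'[of n 0 n] by (simp add: lessThan_atLeast0 mult_2)
    then have "g ` {n..<2 * n} = (\<lambda>i. g (i + n)) ` {..<n}" by (simp add: image_image)
    also have "\<dots> = H" using hH(1) by (simp add: bij_betw_def g_def)
    finally show ?thesis .
  qed
  have sep: "x < y" if "x \<in> L" "y \<in> H" for x y using that by (auto simp: L_def H_def)
  have gmono: "g i < g i'" if "i < i'" "i' < 2 * n" for i i'
  proof -
    have l: "hL k \<in> L" "hH k \<in> H" if "k < n" for k
      using hL(1) hH(1) that by (auto simp: bij_betw_def)
    consider "i' < n" | "i < n" "\<not> i' < n" | "\<not> i < n" "\<not> i' < n" by linarith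
    then show ?thesis
    proof cases
      case 1 then show ?thesis using that hL(2) by (auto simp: g_def strict_mono_on_def)
    next
      case 2 then show ?thesis using that sep l by (auto simp: g_def)
    next
      case 3
      then have "i - n < n" "i' - n < n" "i - n < i' - n" using that by auto
      then show ?thesis using 3 hH(2) by (simp add: g_def strict_mono_on_def)
    qed
  qed
  have ginj: "inj_on g {..<2 * n}"
    by (rule linorder_inj_onI) (use gmono in fastforce)+
  define f where "f x = g (2 * n - 1 - the_inv_into {..<2 * n} g x)" for x
  have fg: "f (g i) = g (2 * n - 1 - i)" if "i < 2 * n" for i
    using that by (simp add: f_def the_inv_into_f_f[OF ginj])
  have rng: "x \<in> L \<union> H \<longleftrightarrow> (\<exists>i<2 * n. x = g i)" for x
  proof -
    have "L \<union> H = g ` ({..<n} \<union> {n..<2 * n})" using gL gH by (simp add: image_Un)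
    also have "{..<n} \<union> {n..<2 * n} = {..<2 * n}" by auto
    finally show ?thesis by auto
  qed
  have "f ` L = H"
  proof -
    have "f ` L = (\<lambda>i. g (2 * n - 1 - i)) ` {..<n}"
      unfolding gL[symmetric] image_image using fg by (intro image_cong) auto
    also have "\<dots> = g ` ((\<lambda>i. 2 * n - 1 - i) ` {..<n})" by (simp add: image_image)
    also have "(\<lambda>i. 2 * n - 1 - i) ` {..<n} = {n..<2 * n}"
    proof (intro equalityI subsetI)
      fix x assume "x \<in> {n..<2 * n}"
      then show "x \<in> (\<lambda>i. 2 * n - 1 - i) ` {..<n}" by (intro image_eqI[of _ _ "2 * n - 1 - x"]) auto
    qed auto
    finally show ?thesis using gH by simp
  qed
  moreover have "f ` H = L"
  proof -
    have "f ` H = (\<lambda>i. g (2 * n - 1 - i)) ` {n..<2 * n}"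
      unfolding gH[symmetric] image_image using fg by (intro image_cong) auto
    also have "\<dots> = g ` ((\<lambda>i. 2 * n - 1 - i) ` {n..<2 * n})" by (simp add: image_image)
    also have "(\<lambda>i. 2 * n - 1 - i) ` {n..<2 * n} = {..<n}"
    proof (intro equalityI subsetI)
      fix x assume "x \<in> {..<n}"
      then show "x \<in> (\<lambda>i. 2 * n - 1 - i) ` {n..<2 * n}" by (intro image_eqI[of _ _ "2 * n - 1 - x"]) auto
    qed auto
    finally show ?thesis using gL by simp
  qed
  moreover have "f y < f x" if xy: "x \<in> L \<union> H" "y \<in> L \<union> H" "x < y" for x y
  proof -
    obtain i i' where i: "i < 2 * n" "x = g i" "i' < 2 * n" "y = g i'" using xy rng by meson
    have "i < i'"
    proof (rule ccontr)
      assume "\<not> i < i'"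
      then have "g i' \<le> g i" using gmono[of i' i] i by (cases "i = i'") auto
      then show False using xy i by simp
    qed
    then show ?thesis using gmono[of "2 * n - 1 - i'" "2 * n - 1 - i"] i fg by auto
  qed
  ultimately show ?thesis by blast
qed

section \<open>Segments of \<open>s\<close> cells in direction \<open>j\<close>\<close>

definition seg_base :: "nat \<Rightarrow> 'd \<Rightarrow> ('d \<Rightarrow> nat) \<Rightarrow> 'd \<Rightarrow> nat" where
  "seg_base s j p = p(j := p j div s * s)"

definition seg_points :: "nat \<Rightarrow> 'd \<Rightarrow> ('d \<Rightarrow> nat) set \<Rightarrow> ('d \<Rightarrow> nat) \<Rightarrow> nat set" where
  "seg_points s j X p = {k. k < s \<and> p(j := p j div s * s + k) \<in> X}"

lemma seg_points_subset: "seg_points s j X p \<subseteq> {..<s}" and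
  finite_seg_points [simp]: "finite (seg_points s j X p)"
  by (auto simp: seg_points_def)

lemma seg_points_base: "s > 0 \<Longrightarrow> seg_points s j X (seg_base s j p) = seg_points s j X p"
  by (simp add: seg_points_def seg_base_def)

lemma mem_seg_points: "s > 0 \<Longrightarrow> p j mod s \<in> seg_points s j X p \<longleftrightarrow> p \<in> X"
  by (simp add: seg_points_def)

lemma block_upd_in_grid:
  assumes "p \<in> grid (M * s)" "k < s"
  shows "p(j := p j div s * s + k) \<in> grid (M * s)"
proof -
  have "p j < M * s" using assms by (auto simp: grid_def)
  then have "p j div s < M" by (simp add: less_mult_imp_div_less)
  then have "Suc (p j div s) * s \<le> M * s" by (intro mult_le_mono1) simp
  then show ?thesis using assms by (auto simp: grid_def)
qed

text \<open>A single movement packs \<open>X\<close> to the bottom of every segment. As it exchanges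
  \<open>X - C\<close> with \<open>C - X\<close>, it also carries \<open>C\<close> back to
  \<open>X\<close>, which \<open>redistribute_segments\<close> uses for unpacking. At most
  \<open>2 * b\<close> cells move, so there are at most \<open>b\<close> couples. The arrays have
  length \<open>s\<close>; the factor \<open>2 * s\<close> makes the cost bound the same as for
  routing.\<close>

lemma compress_segments:
  fixes X :: "('d::finite \<Rightarrow> nat) set" and j :: 'd
  assumes N: "N = M * s" "N > 0" and X: "X \<subseteq> grid N"
    and b: "card X \<le> b"
    and c: "real (2 * s) * real N powr (- 1 - real CARD('d) / 2) * sqrt (real b) \<le> c"
  defines "C \<equiv> {p \<in> grid N. p j mod s < card (seg_points s j X p)}"
  shows "\<exists>z. reachable N c (2 * b) z \<and> z ` X = C \<and> z ` C = X \<and> (\<forall>p i. z p i div s = p i div s)"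
proof -
  have s: "s > 0" using N by (cases s) auto
  obtain F where F: "\<And>A. finite A \<Longrightarrow> F A ` ({..<card A} - A) = A - {..<card A} \<and>
      F A ` (A - {..<card A}) = {..<card A} - A \<and>
      (\<forall>x\<in>({..<card A} - A) \<union> (A - {..<card A}). \<forall>y\<in>({..<card A} - A) \<union> (A - {..<card A}).
          x < y \<longrightarrow> F A y < F A x)"
    using strict_antimono_exchange by metis
  define S where "S p = seg_points s j X p" for p
  have S: "finite (S p)" "S p \<subseteq> {..<s}" "card (S p) \<le> s" for p
    using seg_points_subset[of s j X p] card_mono[of "{..<s}" "S p"] by (auto simp: S_def)
  define U where "U p = ({..<card (S p)} - S p) \<union> (S p - {..<card (S p)})" for p
  define W where "W = (X - C) \<union> (C - X)"
  define z where "z p = (if p \<in> W then p(j := p j div s * s + F (S p) (p j mod s)) else p)" for p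
  have Us: "U p \<subseteq> {..<s}" for p using S(2,3)[of p] by (auto simp: U_def)
  have C_sub: "C \<subseteq> grid N" by (auto simp: C_def)
  have XS: "p \<in> X \<longleftrightarrow> p j mod s \<in> S p" for p by (simp only: S_def mem_seg_points[OF s])
  have CS: "p \<in> C \<longleftrightarrow> p j mod s < card (S p)" if "p \<in> grid N" for p
    using that by (simp add: C_def S_def)
  have S_upd: "S (p(j := p j div s * s + k)) = S p" if "k < s" for p k
    using that by (simp add: S_def seg_points_def)
  have zp: "z p \<in> grid N" "S (z p) = S p" "z p j mod s = F (S p) (p j mod s)" "z p j div s = p j div s"
    "p \<in> X \<Longrightarrow> z p \<in> C - X" "p \<notin> X \<Longrightarrow> z p \<in> X - C" if p: "p \<in> W" for p
  proof -
    have pg: "p \<in> grid N" using p X C_sub by (auto simp: W_def)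
    have Fu: "F (S p) (p j mod s) < s"
      "p \<in> X \<Longrightarrow> F (S p) (p j mod s) \<in> {..<card (S p)} - S p"
      "p \<notin> X \<Longrightarrow> F (S p) (p j mod s) \<in> S p - {..<card (S p)}"
    proof -
      have 1: "F (S p) (p j mod s) \<in> {..<card (S p)} - S p" if "p \<in> X"
      proof -
        have "p j mod s \<in> S p - {..<card (S p)}" using that p XS CS[OF pg] by (auto simp: W_def)
        then show ?thesis using F[OF S(1)[of p]] by blast
      qed
      have 2: "F (S p) (p j mod s) \<in> S p - {..<card (S p)}" if "p \<notin> X"
      proof -
        have "p j mod s \<in> {..<card (S p)} - S p" using that p XS CS[OF pg] by (auto simp: W_def)
        then show ?thesis using F[OF S(1)[of p]] by blast
      qed
      show "F (S p) (p j mod s) < s" using 1 2 S(2,3)[of p] by (cases "p \<in> X") fastforce+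
      show "p \<in> X \<Longrightarrow> F (S p) (p j mod s) \<in> {..<card (S p)} - S p"
        "p \<notin> X \<Longrightarrow> F (S p) (p j mod s) \<in> S p - {..<card (S p)}" using 1 2 by auto
    qed
    have zeq: "z p = p(j := p j div s * s + F (S p) (p j mod s))" using p by (simp add: z_def)
    show g: "z p \<in> grid N" unfolding zeq N(1) by (rule block_upd_in_grid) (use pg N Fu in auto)
    show Sz: "S (z p) = S p" unfolding zeq by (rule S_upd[OF Fu(1)])
    show m: "z p j mod s = F (S p) (p j mod s)" "z p j div s = p j div s"
      unfolding zeq using Fu(1) by auto
    show "p \<in> X \<Longrightarrow> z p \<in> C - X" "p \<notin> X \<Longrightarrow> z p \<in> X - C"
      using Fu(2,3) XS[of "z p"] CS[OF g] unfolding m Sz by auto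
  qed
  have zdiv: "z p i div s = p i div s" for p i
    using zp(4)[of p] by (cases "p \<in> W"; cases "i = j") (auto simp: z_def)
  have fit: "0 \<le> p j \<and> 0 + ((p j - 0) div s + 1) * s \<le> N" if p: "p \<in> W" for p
  proof -
    have "p j < M * s" using p X C_sub N by (auto simp: W_def grid_def)
    then have "p j div s < M" by (simp add: less_mult_imp_div_less)
    then have "(p j div s + 1) * s \<le> M * s" by (intro mult_le_mono1) simp
    then show ?thesis using N by simp
  qed
  have zW: "z p \<in> W" "z p \<noteq> p" if p: "p \<in> W" for p
    using zp(5,6)[OF p] p by (auto simp: W_def)
  have anti: "z q j < z p j" if p: "p \<in> W" and q: "q \<in> W" and e: "\<forall>i. i \<noteq> j \<longrightarrow> q i = p i"
      "(q j - 0) div s = (p j - 0) div s" and lt: "p j < q j" for p q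
  proof -
    have dv: "q j div s = p j div s" using e(2) by simp
    have qp: "q = p(j := p j div s * s + q j mod s)"
    proof
      fix i show "q i = (p(j := p j div s * s + q j mod s)) i"
        using e(1) dv[symmetric] by (cases "i = j") simp_all
    qed
    have Sq: "S q = S p" by (subst qp, rule S_upd) (use s in simp)
    have "p j div s * s + p j mod s < q j div s * s + q j mod s" using lt by simp
    then have lt': "p j mod s < q j mod s" by (simp only: dv add_less_cancel_left)
    have Umem: "r j mod s \<in> U r" if "r \<in> W" for r
      using that XS[of r] CS[of r] X C_sub by (auto simp: W_def U_def)
    have "F (S p) (q j mod s) < F (S p) (p j mod s)"
      using F[OF S(1)[of p]] lt' Umem[OF p] Umem[OF q] unfolding U_def Sq by blast
    then have "z q j mod s < z p j mod s" using zp(3)[OF p] zp(3)[OF q] Sq by simp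
    then have "z q j div s * s + z q j mod s < z p j div s * s + z p j mod s"
      using zdiv[of q j] zdiv[of p j] dv by simp
    then show ?thesis by simp
  qed
  have R: "reachable N (real s * real N powr (- 1 - real CARD('d) / 2) * sqrt (card W / 2)) (card W) z"
  proof (rule reachable_reversal[where r = 0 and j = j, OF N(2) s])
    show "W \<subseteq> grid N" using X C_sub by (auto simp: W_def)
    show "\<forall>p\<in>W. 0 \<le> p j \<and> 0 + ((p j - 0) div s + 1) * s \<le> N" using fit by blast
    show "\<forall>p\<in>W. z p \<in> W \<and> z p \<noteq> p \<and> (\<forall>i. i \<noteq> j \<longrightarrow> z p i = p i) \<and>
       (z p j - 0) div s = (p j - 0) div s"
    proof (intro ballI conjI allI impI)
      fix p i assume p: "p \<in> W"
      show "z p \<in> W" "z p \<noteq> p" using zW[OF p] by auto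
      show "i \<noteq> j \<Longrightarrow> z p i = p i" using p by (simp add: z_def)
      show "(z p j - 0) div s = (p j - 0) div s" by (simp add: zdiv)
    qed
    show "\<forall>p\<in>W. \<forall>q\<in>W. (\<forall>i. i \<noteq> j \<longrightarrow> q i = p i) \<and>
       (q j - 0) div s = (p j - 0) div s \<and> p j < q j \<longrightarrow> z q j < z p j" using anti by blast
    show "\<forall>p. p \<notin> W \<longrightarrow> z p = p" by (simp add: z_def)
  qed
  have bij: "bij_betw z (grid N) (grid N)" using R by (simp add: reachable_def)
  have finW: "finite X" "finite C" using X C_sub finite_grid finite_subset by blast+
  have inj: "inj_on z A" if "A \<subseteq> grid N" for A
    using bij that inj_on_subset by (auto simp: bij_betw_def)
  have sub: "z ` (X - C) \<subseteq> C - X" "z ` (C - X) \<subseteq> X - C" using zp(5,6) by (auto simp: W_def)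
  have le: "card (X - C) \<le> card (C - X)" "card (C - X) \<le> card (X - C)"
    using card_inj_on_le[OF inj sub(1)] card_inj_on_le[OF inj sub(2)] finW X C_sub by blast+
  \<comment> \<open>There are injections both ways, so the two differences have equal size and the
    inclusions are equalities.\<close>
  have eq: "z ` (X - C) = C - X" "z ` (C - X) = X - C"
  proof -
    have "X - C \<subseteq> grid N" "C - X \<subseteq> grid N" using X C_sub by auto
    then have "card (z ` (X - C)) = card (X - C)" "card (z ` (C - X)) = card (C - X)"
      by (simp_all only: card_image[OF inj])
    then show "z ` (X - C) = C - X" "z ` (C - X) = X - C"
      using le finW card_subset_eq[OF _ sub(1)] card_subset_eq[OF _ sub(2)] by simp_all
  qed
  have fix_pt: "z ` (X \<inter> C) = X \<inter> C" by (force simp: z_def W_def)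
  have "z ` X = z ` (X - C) \<union> z ` (X \<inter> C)" by blast
  then have zX: "z ` X = C" using eq fix_pt by auto
  have "z ` C = z ` (C - X) \<union> z ` (X \<inter> C)" by blast
  then have zC: "z ` C = X" using eq fix_pt by auto
  have "card W = card (X - C) + card (C - X)"
    unfolding W_def using finW by (intro card_Un_disjoint) auto
  also have "\<dots> \<le> 2 * card X" using le card_mono[OF finW(1), of "X - C"] by auto
  finally have W2: "card W \<le> 2 * b" using b by simp
  have "real s * real N powr (- 1 - real CARD('d) / 2) * sqrt (card W / 2)
      \<le> real (2 * s) * real N powr (- 1 - real CARD('d) / 2) * sqrt (real b)"
    using W2 by (intro mult_mono real_sqrt_le_mono) auto
  then have "reachable N c (2 * b) z" using R reachable_mono W2 c order_trans by blast
  then show ?thesis using zX zC zdiv by blast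
qed

text \<open>\<open>X\<close> and \<open>Y\<close> have the same packed form, because it depends only
  on the numbers of points in the segments; so \<open>X\<close> is packed and then unpacked to
  \<open>Y\<close>. One reversal per segment would not do: it cannot carry the positions
  \<open>{0, 3}\<close> to \<open>{1, 2}\<close>.\<close>

lemma redistribute_segments:
  fixes X Y :: "('d::finite \<Rightarrow> nat) set"
  assumes N: "N = M * s" "N > 0" and XY: "X \<subseteq> grid N" "Y \<subseteq> grid N"
    and b: "card X \<le> b" "card Y \<le> b"
    and c: "real (2 * s) * real N powr (- 1 - real CARD('d) / 2) * sqrt (real b) \<le> c"
    and eq: "\<And>p. p \<in> grid N \<Longrightarrow> card (seg_points s j X p) = card (seg_points s j Y p)"
  shows "\<exists>z. reachable N (2 * c) (4 * b) z \<and> z ` X = Y \<and> (\<forall>p i. z p i div s = p i div s)"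
proof -
  have same: "{p \<in> grid N. p j mod s < card (seg_points s j X p)}
      = {p \<in> grid N. p j mod s < card (seg_points s j Y p)}" using eq by auto
  obtain z where z: "reachable N c (2 * b) z" "\<forall>p i. z p i div s = p i div s"
      "z ` X = {p \<in> grid N. p j mod s < card (seg_points s j X p)}"
    using compress_segments[OF N XY(1) b(1) c, of j] by auto
  obtain z' where z': "reachable N c (2 * b) z'" "\<forall>p i. z' p i div s = p i div s"
      "z' ` {p \<in> grid N. p j mod s < card (seg_points s j X p)} = Y"
    using compress_segments[OF N XY(2) b(2) c, of j] unfolding same by auto
  have "reachable N (2 * c) (4 * b) (\<lambda>p. z' (z p))"
    using reachable_comp[OF N(2) z(1) z'(1)] by simp
  moreover have "(\<lambda>p. z' (z p)) ` X = Y" using z(3) z'(3) by (metis image_image)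
  ultimately show ?thesis using z(2) z'(2) by (intro exI[of _ "\<lambda>p. z' (z p)"]) simp
qed

subsection \<open>Spreading points over offsets\<close>

text \<open>Values are dealt out in rotation: the elements of \<open>I\<close> receive consecutive
  intervals of \<open>a i\<close> integers, starting from 0, which are reduced modulo
  \<open>s\<close>. As \<open>a i \<le> s\<close>, no value repeats within an interval. The exact
  count, rather than a bound, is what the induction can carry along.\<close>

lemma balanced_sets_exact:
  fixes a :: "'b \<Rightarrow> nat"
  assumes "finite I" "\<forall>i\<in>I. a i \<le> s"
  shows "\<exists>B. (\<forall>i\<in>I. B i \<subseteq> {..<s} \<and> card (B i) = a i) \<and>
    (\<forall>v<s. card {i\<in>I. v \<in> B i} = card {n. n < sum a I \<and> n mod s = v})"
  using assms
proof (induction rule: finite_induct)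
  case empty
  then show ?case by simp
next
  case (insert x I)
  then obtain B where B: "\<forall>i\<in>I. B i \<subseteq> {..<s} \<and> card (B i) = a i"
    "\<forall>v<s. card {i\<in>I. v \<in> B i} = card {n. n < sum a I \<and> n mod s = v}" by auto
  define R where "R = sum a I"
  define T where "T = {R..<R + a x}"
  have aux: "n = n'" if "n \<in> T" "n' \<in> T" "n \<le> n'" "n mod s = n' mod s" for n n'
  proof (rule ccontr)
    assume "n \<noteq> n'"
    have "s dvd n' - n" using that mod_eq_dvd_iff_nat[of n n' s] by simp
    moreover have "0 < n' - n" "n' - n < s" using that \<open>n \<noteq> n'\<close> insert.prems by (auto simp: T_def)
    ultimately show False using nat_dvd_not_less by blast
  qed
  have inj: "inj_on (\<lambda>n. n mod s) T"
    by (rule inj_onI) (metis aux nat_le_linear)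
  define Bx where "Bx = (\<lambda>n. n mod s) ` T"
  have Bx: "Bx \<subseteq> {..<s}" "card Bx = a x"
  proof -
    show "card Bx = a x" unfolding Bx_def card_image[OF inj] by (simp add: T_def)
    have "s > 0" if "T \<noteq> {}" using that insert.prems by (auto simp: T_def)
    then show "Bx \<subseteq> {..<s}" by (cases "T = {}") (auto simp: Bx_def)
  qed
  have cnt: "card {n\<in>T. n mod s = v} = (if v \<in> Bx then 1 else 0)" for v
  proof (cases "v \<in> Bx")
    case True
    then obtain n where n: "n \<in> T" "v = n mod s" by (auto simp: Bx_def)
    then have "{n\<in>T. n mod s = v} = {n}" using inj by (auto dest: inj_onD)
    then show ?thesis using True by simp
  next
    case False
    then have "{n\<in>T. n mod s = v} = {}" by (auto simp: Bx_def)
    then show ?thesis using False by (simp only: card.empty if_False)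
  qed
  show ?case
  proof (intro exI[of _ "B(x := Bx)"] conjI ballI allI impI)
    fix i assume "i \<in> insert x I"
    then show "(B(x := Bx)) i \<subseteq> {..<s}" "card ((B(x := Bx)) i) = a i"
      using B(1) Bx by auto
  next
    fix v assume v: "v < s"
    have "{i\<in>insert x I. v \<in> (B(x := Bx)) i} = {i\<in>I. v \<in> B i} \<union> (if v \<in> Bx then {x} else {})"
      using insert.hyps by auto
    then have "card {i\<in>insert x I. v \<in> (B(x := Bx)) i} = card {i\<in>I. v \<in> B i} + (if v \<in> Bx then 1 else 0)"
      using insert.hyps by simp
    also have "\<dots> = card {n. n < R \<and> n mod s = v} + card {n\<in>T. n mod s = v}"
      using B(2) v by (simp add: cnt R_def)
    also have "\<dots> = card ({n. n < R \<and> n mod s = v} \<union> {n\<in>T. n mod s = v})"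
      by (intro card_Un_disjoint[symmetric]) (auto simp: T_def)
    also have "{n. n < R \<and> n mod s = v} \<union> {n\<in>T. n mod s = v} = {n. n < sum a (insert x I) \<and> n mod s = v}"
      using insert.hyps by (auto simp: T_def R_def)
    finally show "card {i\<in>insert x I. v \<in> (B(x := Bx)) i} = card {n. n < sum a (insert x I) \<and> n mod s = v}" .
  qed
qed

text \<open>Below \<open>s * q\<close> every residue class modulo \<open>s\<close> has
  \<open>q\<close> members, numbered by \<open>n div s\<close>.\<close>

lemma balanced_sets:
  fixes a :: "'b \<Rightarrow> nat"
  assumes "finite I" "\<forall>i\<in>I. a i \<le> s" "sum a I \<le> s * q"
  shows "\<exists>B. (\<forall>i\<in>I. B i \<subseteq> {..<s} \<and> card (B i) = a i) \<and> (\<forall>v<s. card {i\<in>I. v \<in> B i} \<le> q)"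
proof -
  have "card {n. n < sum a I \<and> n mod s = v} \<le> q" for v
  proof -
    have "card {n. n < sum a I \<and> n mod s = v} \<le> card {..<q}"
    proof (rule card_inj_on_le[where f = "\<lambda>n. n div s"])
      show "inj_on (\<lambda>n. n div s) {n. n < sum a I \<and> n mod s = v}"
      proof (rule inj_onI)
        fix x y assume "x \<in> {n. n < sum a I \<and> n mod s = v}" "y \<in> {n. n < sum a I \<and> n mod s = v}"
          "x div s = y div s"
        then have "x div s * s + x mod s = y div s * s + y mod s" by simp
        then show "x = y" by simp
      qed
      show "(\<lambda>n. n div s) ` {n. n < sum a I \<and> n mod s = v} \<subseteq> {..<q}"
        using assms(3) by (auto intro!: less_mult_imp_div_less simp: mult.commute)
    qed simp
    then show ?thesis by simp
  qed
  moreover obtain B where "\<forall>i\<in>I. B i \<subseteq> {..<s} \<and> card (B i) = a i"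
    "\<forall>v<s. card {i\<in>I. v \<in> B i} = card {n. n < sum a I \<and> n mod s = v}"
    using balanced_sets_exact[OF assms(1,2)] by blast
  ultimately show ?thesis by (intro exI[of _ B]) simp
qed

text \<open>Consecutive blocks use opposite orientations, so that exchanging the points with a given offset
  in two adjacent blocks is a reflection, and such couples are nested.\<close>

definition mirror_off :: "nat \<Rightarrow> ('d \<Rightarrow> nat) \<Rightarrow> 'd \<Rightarrow> nat" where
  "mirror_off s p i = (if even (p i div s) then p i mod s else s - 1 - p i mod s)"

lemma mirror_off_less: "s > 0 \<Longrightarrow> mirror_off s p i < s"
  by (simp add: mirror_off_def less_imp_diff_less)

lemma mirror_off_inj:
  assumes "s > 0" "p i div s = q i div s" "mirror_off s p i = mirror_off s q i"
  shows "p i = q i"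
proof -
  have "k = k'" if "s - 1 - k = s - 1 - k'" "k < s" "k' < s" for k k' using that by linarith
  from this[of "p i mod s" "q i mod s"] have "p i mod s = q i mod s"
    using assms by (auto simp: mirror_off_def split: if_splits)
  then show ?thesis using assms(2) by (metis div_mult_mod_eq)
qed

lemma card_eq_sum_seg_points:
  fixes X :: "('d::finite \<Rightarrow> nat) set" and j :: 'd
  assumes s: "s > 0" and X: "X \<subseteq> grid N"
  shows "card X = (\<Sum>a\<in>seg_base s j ` grid N. card (seg_points s j X a))"
proof -
  have finX: "finite X" using X finite_grid finite_subset by blast
  have "card X = (\<Sum>a\<in>seg_base s j ` X. card {p \<in> X. seg_base s j p = a})"
    using sum.image_gen[OF finX, of "\<lambda>_. 1::nat" "seg_base s j"] by simp
  also have "\<dots> = (\<Sum>a\<in>seg_base s j ` grid N. card {p \<in> X. seg_base s j p = a})"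
  proof (rule sum.mono_neutral_left)
    show "\<forall>a\<in>seg_base s j ` grid N - seg_base s j ` X. card {p \<in> X. seg_base s j p = a} = 0"
    proof
      fix a assume "a \<in> seg_base s j ` grid N - seg_base s j ` X"
      then have "{p \<in> X. seg_base s j p = a} = {}" by blast
      then show "card {p \<in> X. seg_base s j p = a} = 0" by (simp only: card.empty)
    qed
  qed (use X in auto)
  also have "\<dots> = (\<Sum>a\<in>seg_base s j ` grid N. card (seg_points s j X a))"
  proof (rule sum.cong[OF refl])
    fix a assume "a \<in> seg_base s j ` grid N"
    then obtain g where a: "a = seg_base s j g" by blast
    have a': "a j div s * s = a j" using s by (simp add: a seg_base_def)
    have "{p \<in> X. seg_base s j p = a} = (\<lambda>k. a(j := a j + k)) ` seg_points s j X a"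
    proof (intro equalityI subsetI)
      fix p assume p: "p \<in> {p \<in> X. seg_base s j p = a}"
      then have "p = a(j := a j + p j mod s)" by (auto simp: seg_base_def)
      moreover have "p j mod s \<in> seg_points s j X a"
        using p s calculation by (simp add: seg_points_def a')
      ultimately show "p \<in> (\<lambda>k. a(j := a j + k)) ` seg_points s j X a" by blast
    next
      fix p assume "p \<in> (\<lambda>k. a(j := a j + k)) ` seg_points s j X a"
      then obtain k where k: "k < s" "a(j := a j + k) \<in> X" "p = a(j := a j + k)"
        by (auto simp: seg_points_def a')
      have "(a j + k) div s * s = a j" using k(1) a' by (metis div_mult_self4 add.commute div_eq_0_iff add_cancel_left_right mult.commute s less_not_refl)
      then show "p \<in> {p \<in> X. seg_base s j p = a}" using k by (simp add: seg_base_def)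
    qed
    moreover have "inj_on (\<lambda>k. a(j := a j + k)) (seg_points s j X a)"
      by (rule inj_onI) (metis add_left_cancel fun_upd_same)
    ultimately show "card {p \<in> X. seg_base s j p = a} = card (seg_points s j X a)"
      by (simp add: card_image)
  qed
  finally show ?thesis .
qed

text \<open>Moving in direction \<open>j\<close> leaves the offsets in \<open>J\<close> unchanged,
  so all segments with common offsets in \<open>J\<close> form a class that can be treated by
  itself. It holds at most \<open>s * q\<close> points, and dealing out the \<open>s\<close> offsets
  in direction \<open>j\<close> evenly leaves at most \<open>q\<close> points with each. The numbers
  of points in the segments are kept, so \<open>redistribute_segments\<close> can realize
  \<open>Y\<close>.\<close>

lemma balance_offsets:
  fixes X :: "('d::finite \<Rightarrow> nat) set" and j :: 'd
  assumes N: "N = M * s" "N > 0" and X: "X \<subseteq> grid N" and jJ: "j \<notin> J"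
    and load: "\<forall>v. card {p \<in> X. \<forall>i\<in>J. mirror_off s p i = v i} \<le> s * q"
  shows "\<exists>Y \<subseteq> grid N. card Y = card X \<and>
    (\<forall>p\<in>grid N. card (seg_points s j X p) = card (seg_points s j Y p)) \<and>
    (\<forall>v. card {p \<in> Y. \<forall>i\<in>insert j J. mirror_off s p i = v i} \<le> q)"
proof -
  have s: "s > 0" using N by (cases s) auto
  define Bs where "Bs = seg_base s j ` grid N"
  have finBs: "finite Bs" by (simp add: Bs_def)
  \<comment> \<open>The default 0 outside \<open>J\<close> makes classes equal as functions as soon
    as the offsets in \<open>J\<close> agree.\<close>
  define cls where "cls w = (\<lambda>i. if i \<in> J then w i else 0)" for w :: "'d \<Rightarrow> nat"
  define I where "I c = {a \<in> Bs. cls (mirror_off s a) = c}" for c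
  define n where "n a = card (seg_points s j X a)" for a
  define Q where "Q c B \<longleftrightarrow> (\<forall>a\<in>I c. B a \<subseteq> {..<s} \<and> card (B a) = n a) \<and>
    (\<forall>v<s. card {a\<in>I c. v \<in> B a} \<le> q)" for c B
  have "\<exists>B. Q c B" for c
    unfolding Q_def
  proof (rule balanced_sets)
    show "finite (I c)" using finBs by (simp add: I_def)
    show "\<forall>i\<in>I c. n i \<le> s"
      using card_mono[OF finite_lessThan seg_points_subset] by (fastforce simp: n_def)
    let ?X = "{p \<in> X. \<forall>i\<in>J. mirror_off s p i = c i}"
    \<comment> \<open>All cells of such a segment share their offsets in \<open>J\<close>, so
      restricting \<open>X\<close> to the class loses no point of the segment.\<close>
    have "n a = card (seg_points s j ?X a)" if "a \<in> I c" for a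
    proof -
      have "mirror_off s (a(j := k)) i = c i" if "i \<in> J" for i k
      proof -
        have "cls (mirror_off s a) i = c i" using \<open>a \<in> I c\<close> by (auto simp: I_def)
        then show ?thesis using that jJ by (auto simp: cls_def mirror_off_def)
      qed
      then have "seg_points s j X a = seg_points s j ?X a" by (auto simp: seg_points_def)
      then show ?thesis by (simp add: n_def)
    qed
    then have "sum n (I c) = (\<Sum>a\<in>I c. card (seg_points s j ?X a))" by simp
    also have "\<dots> \<le> (\<Sum>a\<in>Bs. card (seg_points s j ?X a))"
      using finBs by (intro sum_mono2) (auto simp: I_def)
    also have "\<dots> = card ?X"
      unfolding Bs_def by (rule card_eq_sum_seg_points[symmetric, OF s]) (use X in auto)
    also have "\<dots> \<le> s * q" using load by blast
    finally show "sum n (I c) \<le> s * q" .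
  qed
  then obtain B where QB: "\<And>c. Q c (B c)" by metis
  have B: "a \<in> I c \<Longrightarrow> B c a \<subseteq> {..<s} \<and> card (B c a) = n a"
    "v < s \<Longrightarrow> card {a\<in>I c. v \<in> B c a} \<le> q" for c a v
    using QB[of c] by (auto simp: Q_def)
  define Bf where "Bf a = B (cls (mirror_off s a)) a" for a
  have Bf: "Bf a \<subseteq> {..<s}" "card (Bf a) = n a" if "a \<in> Bs" for a
    using B(1)[of a "cls (mirror_off s a)"] that by (auto simp: I_def Bf_def)
  \<comment> \<open>\<open>Bf\<close> prescribes mirrored offsets; in blocks of odd number the
    actual positions are their reflections, which does not affect the counts.\<close>
  define Y where "Y = {p \<in> grid N. mirror_off s p j \<in> Bf (seg_base s j p)}"
  have Ygrid: "Y \<subseteq> grid N" by (auto simp: Y_def)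
  have segY: "card (seg_points s j X p) = card (seg_points s j Y p)" if p: "p \<in> grid N" for p
  proof -
    have pB: "seg_base s j p \<in> Bs" using p by (simp add: Bs_def)
    have mem: "k \<in> seg_points s j Y p \<longleftrightarrow>
        k < s \<and> (if even (p j div s) then k else s - 1 - k) \<in> Bf (seg_base s j p)" for k
    proof -
      have "p(j := p j div s * s + k) \<in> grid N" if "k < s"
        using block_upd_in_grid[OF p[unfolded N(1)] that] N(1) by simp
      then show ?thesis
        by (auto simp: seg_points_def Y_def seg_base_def mirror_off_def)
    qed
    have "card (seg_points s j Y p) = card (Bf (seg_base s j p))"
    proof (cases "even (p j div s)")
      case True
      then have "seg_points s j Y p = Bf (seg_base s j p)" using mem Bf(1)[OF pB] by auto
      then show ?thesis by simp
    next
      case False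
      have "bij_betw (\<lambda>k. s - 1 - k) (seg_points s j Y p) (Bf (seg_base s j p))"
      proof (rule bij_betw_byWitness[where f' = "\<lambda>k. s - 1 - k"])
        show "(\<lambda>k. s - 1 - k) ` Bf (seg_base s j p) \<subseteq> seg_points s j Y p"
          using False Bf(1)[OF pB] by (auto simp: mem)
      qed (use False Bf(1)[OF pB] in \<open>auto simp: mem\<close>)
      then show ?thesis by (rule bij_betw_same_card)
    qed
    also have "\<dots> = card (seg_points s j X p)"
      using Bf(2)[OF pB] by (simp add: n_def seg_points_base[OF s])
    finally show ?thesis by simp
  qed
  have "card Y = card X"
    unfolding card_eq_sum_seg_points[OF s X, of j] card_eq_sum_seg_points[OF s Ygrid, of j]
  proof (rule sum.cong[OF refl])
    fix a assume "a \<in> seg_base s j ` grid N"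
    then obtain p where "p \<in> grid N" "a = seg_base s j p" by blast
    then show "card (seg_points s j Y a) = card (seg_points s j X a)"
      using segY[of p] by (simp add: seg_points_base[OF s])
  qed
  moreover have "card {p \<in> Y. \<forall>i\<in>insert j J. mirror_off s p i = v i} \<le> q" for v
  proof (cases "v j < s")
    case True
    let ?c = "cls v"
    have "card {p \<in> Y. \<forall>i\<in>insert j J. mirror_off s p i = v i} \<le> card {a\<in>I ?c. v j \<in> B ?c a}"
    \<comment> \<open>A segment contains just one cell with a given offset in direction
      \<open>j\<close>, so counting points amounts to counting segments.\<close>
    proof (rule card_inj_on_le[where f = "seg_base s j"])
      show "finite {a\<in>I ?c. v j \<in> B ?c a}" using finBs by (simp add: I_def)
      show "inj_on (seg_base s j) {p \<in> Y. \<forall>i\<in>insert j J. mirror_off s p i = v i}"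
      proof (rule inj_onI)
        fix p p' assume p: "p \<in> {p \<in> Y. \<forall>i\<in>insert j J. mirror_off s p i = v i}"
          "p' \<in> {p \<in> Y. \<forall>i\<in>insert j J. mirror_off s p i = v i}"
          and e: "seg_base s j p = seg_base s j p'"
        have "p i = p' i" if "i \<noteq> j" for i
          using fun_cong[OF e, of i] that by (simp add: seg_base_def)
        moreover have "p j div s = p' j div s"
          using fun_cong[OF e, of j] s by (simp add: seg_base_def)
        then have "p j = p' j" using mirror_off_inj[OF s, of p j p'] p by auto
        ultimately show "p = p'" by (metis ext)
      qed
      show "seg_base s j ` {p \<in> Y. \<forall>i\<in>insert j J. mirror_off s p i = v i} \<subseteq> {a\<in>I ?c. v j \<in> B ?c a}"
      proof (intro image_subsetI)
        fix p assume p: "p \<in> {p \<in> Y. \<forall>i\<in>insert j J. mirror_off s p i = v i}"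
        have c: "cls (mirror_off s (seg_base s j p)) = ?c"
          using p jJ by (auto simp: cls_def fun_eq_iff mirror_off_def seg_base_def)
        have "seg_base s j p \<in> I ?c" using p Ygrid c by (auto simp: I_def Bs_def)
        moreover have "v j \<in> B ?c (seg_base s j p)" using p c by (auto simp: Y_def Bf_def)
        ultimately show "seg_base s j p \<in> {a\<in>I ?c. v j \<in> B ?c a}" by blast
      qed
    qed
    then show ?thesis using B(2)[OF True, of ?c] by linarith
  next
    case False
    then have "mirror_off s p j \<noteq> v j" for p using mirror_off_less[OF s, of p j] by linarith
    then have "{p \<in> Y. \<forall>i\<in>insert j J. mirror_off s p i = v i} = {}" by blast
    then show ?thesis by (simp only: card.empty)
  qed
  ultimately show ?thesis using Ygrid segY by blast
qed

text \<open>Induction over the directions: each takes two movements and divides by \<open>s\<close>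
  the bound on the number of points with equal offsets. It starts from
  \<open>b \<le> s ^ CARD('d)\<close> with no direction treated and ends, for
  \<open>J = UNIV\<close>, with at most one point for each offset.\<close>

lemma spread_offsets:
  fixes X :: "('d::finite \<Rightarrow> nat) set"
  assumes N: "N = M * s" "N > 0" and X: "X \<subseteq> grid N"
    and b: "card X \<le> b" "b \<le> s ^ CARD('d)"
    and c: "real (2 * s) * real N powr (- 1 - real CARD('d) / 2) * sqrt (real b) \<le> c"
  shows "\<exists>z. reachable N (2 * real (card J) * c) (4 * card J * b) z \<and> (\<forall>p i. z p i div s = p i div s) \<and>
    (\<forall>v. card {p \<in> z ` X. \<forall>i\<in>J. mirror_off s p i = v i} \<le> s ^ (CARD('d) - card (J :: 'd set)))"
proof -
  have "finite J" by simp
  then show ?thesis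
  proof (induction rule: finite_induct)
    case empty
    show ?case using b reachable_id by (intro exI[of _ "\<lambda>p. p"]) simp
  next
    case (insert j J)
    then obtain z where z: "reachable N (2 * real (card J) * c) (4 * card J * b) z"
      "\<forall>p i. z p i div s = p i div s"
      "\<forall>v. card {p \<in> z ` X. \<forall>i\<in>J. mirror_off s p i = v i} \<le> s ^ (CARD('d) - card J)" by blast
    have "card (insert j J) \<le> CARD('d)" by (rule card_mono) auto
    then have lt: "card J < CARD('d)" using insert.hyps by simp
    have zb: "bij_betw z (grid N) (grid N)" using z(1) by (simp add: reachable_def)
    have zX: "z ` X \<subseteq> grid N" "card (z ` X) \<le> b"
      using zb X b(1) card_image_le[OF finite_subset[OF X finite_grid], of z]
      by (auto simp: bij_betw_def)
    have "s ^ (CARD('d) - card J) = s * s ^ (CARD('d) - card (insert j J))"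
      using lt insert.hyps by (simp flip: power_Suc add: Suc_diff_Suc)
    then have "\<forall>v. card {p \<in> z ` X. \<forall>i\<in>J. mirror_off s p i = v i} \<le> s * s ^ (CARD('d) - card (insert j J))"
      using z(3) by simp
    from balance_offsets[OF N zX(1) insert.hyps(2) this] obtain Y where Y: "Y \<subseteq> grid N" "card Y = card (z ` X)"
      "\<forall>p\<in>grid N. card (seg_points s j (z ` X) p) = card (seg_points s j Y p)"
      "\<forall>v. card {p \<in> Y. \<forall>i\<in>insert j J. mirror_off s p i = v i} \<le> s ^ (CARD('d) - card (insert j J))"
      by blast
    obtain z' where z': "reachable N (2 * c) (4 * b) z'" "z' ` z ` X = Y" "\<forall>p i. z' p i div s = p i div s"
      using redistribute_segments[OF N zX(1) Y(1) zX(2) _ c, of j] Y(2,3) zX(2) by auto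
    have "reachable N (2 * real (card (insert j J)) * c) (4 * card (insert j J) * b) (\<lambda>p. z' (z p))"
      using reachable_comp[OF N(2) z(1) z'(1)] insert.hyps by (simp add: algebra_simps)
    moreover have "(\<lambda>p. z' (z p)) ` X = Y" using z'(2) by (simp add: image_image)
    ultimately show ?case using z(2) z'(3) Y(4) by (intro exI[of _ "\<lambda>p. z' (z p)"]) simp
  qed
qed

subsection \<open>Routing along blocks of equal offset\<close>

text \<open>The cell with mirrored offset \<open>v\<close> in block \<open>c\<close>: the inverse of
  taking the block numbers \<open>p i div s\<close> together with
  \<open>mirror_off s p\<close>.\<close>

definition pos :: "nat \<Rightarrow> ('d \<Rightarrow> nat) \<Rightarrow> ('d \<Rightarrow> nat) \<Rightarrow> 'd \<Rightarrow> nat" where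
  "pos s c v i = c i * s + (if even (c i) then v i else s - 1 - v i)"

lemma pos_div: "v i < s \<Longrightarrow> pos s c v i div s = c i"
  by (simp add: pos_def div_add1_eq less_imp_diff_less)

lemma mirror_off_pos: "v i < s \<Longrightarrow> mirror_off s (pos s c v) i = v i"
proof -
  assume v: "v i < s"
  define k where "k = (if even (c i) then v i else s - 1 - v i)"
  have "k < s" using v by (auto simp: k_def)
  then have "pos s c v i mod s = k" by (simp add: pos_def k_def[symmetric])
  then show ?thesis using v by (simp add: mirror_off_def pos_div k_def)
qed

lemma pos_mirror_off:
  assumes "s > 0"
  shows "pos s (\<lambda>i. p i div s) (mirror_off s p) = p"
proof
  fix i
  have "p i mod s < s" using assms by simp
  then show "pos s (\<lambda>i. p i div s) (mirror_off s p) i = p i"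
    by (simp add: pos_def mirror_off_def)
qed

lemma pos_in_grid:
  assumes "\<forall>i. v i < s" "\<forall>i. c i < M"
  shows "pos s c v \<in> grid (M * s)"
proof -
  have "pos s c v i < M * s" for i
  proof -
    have v: "v i < s" "c i < M" using assms by auto
    then have "pos s c v i < Suc (c i) * s" by (auto simp: pos_def)
    also have "\<dots> \<le> M * s" using v by (intro mult_le_mono1) simp
    finally show ?thesis .
  qed
  then show ?thesis by (simp add: grid_def)
qed

text \<open>The blocks numbered \<open>r + 2 * u\<close> and \<open>r + 2 * u + 1\<close> together
  occupy the coordinates from \<open>r * s + 2 * u * s\<close> to
  \<open>r * s + 2 * u * s + 2 * s - 1\<close>. The constant in \<open>R\<close> is the sum of these
  extremes, so \<open>R\<close> reflects the double block, and equal mirrored offsets are mirror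
  images.\<close>

lemma pos_pair:
  assumes v: "\<forall>i. v i < s" and c: "c j = r + 2 * u"
  defines "c' \<equiv> c(j := c j + 1)"
  defines "R \<equiv> \<lambda>p. p(j := 2 * r * s + 4 * s * u + 2 * s - 1 - p j)"
  shows "R (pos s c v) = pos s c' v" "R (pos s c' v) = pos s c v"
    "(pos s c v j - r * s) div (2 * s) = u" "(pos s c' v j - r * s) div (2 * s) = u"
    "r * s \<le> pos s c v j" "r * s \<le> pos s c' v j"
proof -
  define k where "k = (if even (c j) then v j else s - 1 - v j)"
  have vj: "v j < s" using v by blast
  have k: "k < s" using vj by (auto simp: k_def)
  have p: "pos s c v j = r * s + 2 * u * s + k"
    by (simp add: pos_def c k_def algebra_simps)
  have p': "pos s c' v j = r * s + 2 * u * s + s + (s - 1 - k)"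
    using vj by (auto simp: pos_def c'_def c k_def algebra_simps)
  have oth: "pos s c v i = pos s c' v i" if "i \<noteq> j" for i using that by (simp add: pos_def c'_def)
  have e: "2 * r * s + 4 * s * u + 2 * s - 1 - pos s c v j = pos s c' v j"
    "2 * r * s + 4 * s * u + 2 * s - 1 - pos s c' v j = pos s c v j"
    unfolding p p' using k by (simp_all add: algebra_simps)
  show "R (pos s c v) = pos s c' v" "R (pos s c' v) = pos s c v"
    using oth unfolding R_def e by auto
  have s: "2 * s > 0" using k by simp
  show "(pos s c v j - r * s) div (2 * s) = u"
    unfolding p using k s by (simp add: div_nat_eqI algebra_simps)
  show "(pos s c' v j - r * s) div (2 * s) = u"
    unfolding p' using k s by (simp add: div_nat_eqI algebra_simps)
  show "r * s \<le> pos s c v j" "r * s \<le> pos s c' v j" unfolding p p' by auto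
qed

text \<open>The l^1 distance: at most one of the two truncated differences is nonzero.\<close>

definition block_dist :: "('d::finite \<Rightarrow> nat) \<Rightarrow> ('d \<Rightarrow> nat) \<Rightarrow> nat" where
  "block_dist c t = (\<Sum>i\<in>UNIV. (c i - t i) + (t i - c i))"

text \<open>For fixed \<open>j\<close> and \<open>r\<close> the blocks numbered \<open>2 u + r\<close> and \<open>2 u + r + 1\<close> in direction \<open>j\<close>
  are paired, so that all exchanges of one movement take place in disjoint arrays.\<close>

definition advance :: "('d \<Rightarrow> nat) \<Rightarrow> 'd \<times> nat \<Rightarrow> ('d \<Rightarrow> nat) \<Rightarrow> 'd \<Rightarrow> nat" where
  "advance t jr c = (case jr of (j, r) \<Rightarrow>
     if c j < t j \<and> c j mod 2 = r then c(j := c j + 1)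
     else if t j < c j \<and> c j mod 2 \<noteq> r then c(j := c j - 1) else c)"

text \<open>Additive on both sides to avoid truncated subtraction.\<close>

lemma block_dist_upd:
  "block_dist (c(j := k)) t + ((c j - t j) + (t j - c j)) = block_dist c t + ((k - t j) + (t j - k))"
  by (simp add: block_dist_def sum.remove[OF _ UNIV_I[of j]] cong: if_cong)

text \<open>A step up and a step down both exchange a pair of adjacent blocks; naming the lower
  block \<open>c0\<close> lets \<open>pos_pair\<close> serve for both. The bound by the maximum
  keeps the upper block inside the grid.\<close>

lemma advance_cases:
  assumes "r < 2" "advance t (j, r) c \<noteq> c"
  shows "block_dist (advance t (j, r) c) t < block_dist c t"
    "\<exists>c0 u. c0 j = r + 2 * u \<and> c0 j + 1 \<le> max (c j) (t j) \<and>
       (c = c0 \<and> advance t (j, r) c = c0(j := c0 j + 1) \<or> c = c0(j := c0 j + 1) \<and> advance t (j, r) c = c0)"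
proof -
  consider "c j < t j" "c j mod 2 = r" "advance t (j, r) c = c(j := c j + 1)"
    | "t j < c j" "c j mod 2 \<noteq> r" "advance t (j, r) c = c(j := c j - 1)"
    using assms(2) by (auto simp: advance_def split: if_splits)
  note cs = this
  show "block_dist (advance t (j, r) c) t < block_dist c t"
    using cs
  proof cases
    case 1
    then show ?thesis using block_dist_upd[of c j "c j + 1" t] by simp
  next
    case 2
    then show ?thesis using block_dist_upd[of c j "c j - 1" t] by simp
  qed
  show "\<exists>c0 u. c0 j = r + 2 * u \<and> c0 j + 1 \<le> max (c j) (t j) \<and>
       (c = c0 \<and> advance t (j, r) c = c0(j := c0 j + 1) \<or> c = c0(j := c0 j + 1) \<and> advance t (j, r) c = c0)"
    using cs
  proof cases
    case 1
    then have "c j = r + 2 * (c j div 2)" by (metis add.commute mult.commute div_mult_mod_eq)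
    then show ?thesis using 1 by (intro exI[of _ c] exI[of _ "c j div 2"]) auto
  next
    case 2
    have "c j - 1 = r + 2 * ((c j - 1) div 2)" using 2 assms(1) by presburger
    then show ?thesis using 2 by (intro exI[of _ "c(j := c j - 1)"] exI[of _ "(c j - 1) div 2"]) auto
  qed
qed

lemma advance_le:
  assumes "r < 2"
  shows "block_dist (advance t (j, r) c) t \<le> block_dist c t"
  using advance_cases(1)[OF assms, of t j c] by (cases "advance t (j, r) c = c") auto

lemma advance_bound:
  assumes "\<forall>i. c i < M" "\<forall>i. t i < M"
  shows "advance t jr c i < M"
proof -
  obtain j r where jr: "jr = (j, r)" by (cases jr)
  have "c j < t j \<Longrightarrow> c j + 1 < M" using assms(2) by (metis Suc_eq_plus1 Suc_leI order.strict_trans1)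
  then show ?thesis using assms(1) by (auto simp: advance_def jr less_imp_diff_less)
qed

lemma fold_advance_le:
  assumes "\<forall>(j, r)\<in>set js. r < 2"
  shows "block_dist (fold (advance t) js c) t \<le> block_dist c t"
  using assms
proof (induction js arbitrary: c)
  case (Cons x js)
  obtain j r where x: "x = (j, r)" by (cases x)
  show ?case using Cons.IH[of "advance t x c"] Cons.prems advance_le[of r t j c] by (simp add: x)
qed simp

text \<open>If no earlier step of the list makes progress, the block is still \<open>c\<close> when
  the turn of \<open>x\<close> comes, and then \<open>x\<close> makes progress.\<close>

lemma fold_advance_less:
  assumes "\<forall>(j, r)\<in>set js. r < 2" "x \<in> set js" "advance t x c \<noteq> c"
  shows "block_dist (fold (advance t) js c) t < block_dist c t"
  using assms
proof (induction js)
  case (Cons y js)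
  obtain j r where y: "y = (j, r)" by (cases y)
  have js: "\<forall>(j, r)\<in>set js. r < 2" "r < 2" using Cons.prems by (auto simp: y)
  show ?case
  proof (cases "advance t y c = c")
    case True
    then have "x \<in> set js" using Cons.prems by auto
    then show ?thesis using Cons.IH js(1) Cons.prems(3) True by simp
  next
    case False
    then have "block_dist (advance t y c) t < block_dist c t" using advance_cases(1)[OF js(2)] y by blast
    then show ?thesis using fold_advance_le[OF js(1), of t "advance t y c"] by simp
  qed
qed simp

lemma block_dist_eq_0: "block_dist c t = 0 \<longleftrightarrow> c = t"
  by (auto simp: block_dist_def fun_eq_iff intro: order.antisym)

text \<open>A round tries each direction with both pairings, so it brings a block that is not yet at
  its target at least one step closer.\<close>

lemma fold_advance_rounds:
  assumes js: "set js = UNIV \<times> {0, 1}" and "block_dist c t \<le> D"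
  shows "fold (advance t) (concat (replicate D js)) c = t"
  using assms(2)
proof (induction D arbitrary: c)
  case 0
  then show ?case by (simp add: block_dist_eq_0)
next
  case (Suc D)
  have js2: "\<forall>(j, r)\<in>set js. r < 2" using js by auto
  have "block_dist (fold (advance t) js c) t \<le> D"
  proof (cases "c = t")
    case True
    then have "block_dist c t = 0" by (simp add: block_dist_eq_0)
    then show ?thesis using fold_advance_le[OF js2, of t c] by simp
  next
    case False
    then obtain j where j: "c j \<noteq> t j" by blast
    \<comment> \<open>The pairing in which the neighbour towards \<open>t\<close> in direction
      \<open>j\<close> is the partner: \<open>c j\<close> is the lower number of its pair when it
      must grow and the upper one when it must shrink.\<close>
    define r where "r = (if c j < t j then c j mod 2 else 1 - c j mod 2)"
    have r: "r \<in> {0, 1}" by (auto simp: r_def)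
    have "advance t (j, r) c j \<noteq> c j"
      using j by (auto simp: advance_def r_def) presburger
    then have "advance t (j, r) c \<noteq> c" by metis
    moreover have "(j, r) \<in> set js" using js r by auto
    ultimately show ?thesis using fold_advance_less[OF js2] Suc.prems by fastforce
  qed
  then show ?case using Suc.IH by simp
qed

text \<open>The strict inequality in the invariant says that a point which has already been pushed lies
  behind the travelling point of the same offset, and hence is never pushed again.\<close>

definition routing_state where
  "routing_state M s Q t w g \<longleftrightarrow>
     bij_betw w (grid (M * s)) (grid (M * s)) \<and>
     (\<forall>q\<in>Q. w q = pos s (g q) (mirror_off s q) \<and> (\<forall>i. g q i < M)) \<and>
     (\<forall>p\<in>grid (M * s) - Q. mirror_off s (w p) = mirror_off s p \<and>
        (\<forall>i. w p i div s \<le> p i div s + 1 \<and> p i div s \<le> w p i div s + 1) \<and>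
        (\<forall>q\<in>Q. mirror_off s q = mirror_off s p \<longrightarrow>
           w p = p \<or> block_dist (g q) (t q) < block_dist (\<lambda>i. w p i div s) (t q)))"

text \<open>\<open>w p\<close> is the present cell of what started in \<open>p\<close>,
  \<open>g q\<close> the present block of the traveller \<open>q\<close>, and \<open>t q\<close> its
  target. Different travellers have different offsets, so the pairs of cells they use are disjoint.
  What \<open>q\<close> displaces was in a block strictly closer to \<open>t q\<close>, so by the
  invariant it was still at its starting cell; afterwards it is in the block that \<open>q\<close>
  has left, farther from \<open>t q\<close> than \<open>q\<close> is.\<close>

lemma routing_step:
  fixes Q :: "('d::finite \<Rightarrow> nat) set" and j :: 'd
  assumes N: "N = M * s" "N > 0" and Q: "Q \<subseteq> grid N" "card Q \<le> b"
    and inj: "inj_on (mirror_off s) Q" and t: "\<forall>q\<in>Q. \<forall>i. t q i < M"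
    and c: "real (2 * s) * real N powr (- 1 - real CARD('d) / 2) * sqrt (real b) \<le> c"
    and st: "routing_state M s Q t w g" and r: "r < 2"
  shows "\<exists>z. reachable N c (2 * b) z \<and>
    routing_state M s Q t (\<lambda>p. z (w p)) (\<lambda>q. advance (t q) (j, r) (g q))"
proof -
  have s: "s > 0" using N by (cases s) auto
  define o' where "o' = (mirror_off s :: ('d \<Rightarrow> nat) \<Rightarrow> _)"
  have o'_less: "\<forall>i. o' p i < s" for p by (simp add: o'_def mirror_off_less[OF s])
  define g' where "g' q = advance (t q) (j, r) (g q)" for q
  have w: "bij_betw w (grid N) (grid N)"
    and wQ: "\<And>q. q \<in> Q \<Longrightarrow> w q = pos s (g q) (o' q)" "\<And>q i. q \<in> Q \<Longrightarrow> g q i < M"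
    and wp: "\<And>p. p \<in> grid N - Q \<Longrightarrow> o' (w p) = o' p"
      "\<And>p i. p \<in> grid N - Q \<Longrightarrow> w p i div s \<le> p i div s + 1 \<and> p i div s \<le> w p i div s + 1"
      "\<And>p q. \<lbrakk>p \<in> grid N - Q; q \<in> Q; o' q = o' p\<rbrakk> \<Longrightarrow>
           w p = p \<or> block_dist (g q) (t q) < block_dist (\<lambda>i. w p i div s) (t q)"
    using st unfolding routing_state_def N(1) o'_def by blast+
  have injQ: "q = q'" if "q \<in> Q" "q' \<in> Q" "o' q = o' q'" for q q'
    using inj that by (auto simp: o'_def dest: inj_onD)
  have g'M: "g' q i < M" if "q \<in> Q" for q i
    unfolding g'_def by (rule advance_bound) (use wQ(2)[OF that] t that in auto)
  define K where "K = {q \<in> Q. g' q \<noteq> g q}"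
  define W where "W = (\<Union>q\<in>K. {pos s (g q) (o' q), pos s (g' q) (o' q)})"
  define u where "u p = (p j - r * s) div (2 * s)" for p :: "'d \<Rightarrow> nat"
  define R where "R p = p(j := 2 * r * s + 4 * s * u p + 2 * s - 1 - p j)" for p :: "'d \<Rightarrow> nat"
  define z where "z p = (if p \<in> W then R p else p)" for p
  have pair: "R (pos s (g q) (o' q)) = pos s (g' q) (o' q) \<and> R (pos s (g' q) (o' q)) = pos s (g q) (o' q) \<and>
      u (pos s (g q) (o' q)) = u (pos s (g' q) (o' q)) \<and>
      (\<forall>p\<in>{pos s (g q) (o' q), pos s (g' q) (o' q)}. r * s \<le> p j \<and> r * s + (u p + 1) * (2 * s) \<le> N)"
    if q: "q \<in> K" for q
  proof -
    have qQ: "q \<in> Q" "advance (t q) (j, r) (g q) \<noteq> g q" using q by (auto simp: K_def g'_def)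
    obtain c0 v where c0: "c0 j = r + 2 * v" "c0 j + 1 \<le> max (g q j) (t q j)"
      "g q = c0 \<and> g' q = c0(j := c0 j + 1) \<or> g q = c0(j := c0 j + 1) \<and> g' q = c0"
      using advance_cases(2)[OF r qQ(2)] unfolding g'_def by blast
    note pp = pos_pair[where c = c0 and j = j and r = r and u = v, OF o'_less[of q] c0(1)]
    have uu: "u (pos s c0 (o' q)) = v" "u (pos s (c0(j := c0 j + 1)) (o' q)) = v"
      using pp(3,4) by (simp_all add: u_def)
    have RR: "R (pos s c0 (o' q)) = pos s (c0(j := c0 j + 1)) (o' q)"
      "R (pos s (c0(j := c0 j + 1)) (o' q)) = pos s c0 (o' q)"
      using pp(1,2) unfolding R_def uu by simp_all
    have "max (g q j) (t q j) < M" using wQ(2)[OF qQ(1)] t qQ(1) by simp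
    with c0(2) have "c0 j + 1 < M" by (rule le_less_trans)
    then have "r + 2 * v + 2 \<le> M" by (simp add: c0(1))
    then have "(r + 2 * v + 2) * s \<le> M * s" by (rule mult_le_mono1)
    then have fit: "r * s + (v + 1) * (2 * s) \<le> N" using N(1) by (simp add: algebra_simps)
    show ?thesis using c0(3) RR uu fit pp(5,6) by (elim disjE conjE) (simp_all del: fun_upd_apply)
  qed
  have gg': "g q \<noteq> g' q" "block_dist (g' q) (t q) < block_dist (g q) (t q)" if "q \<in> K" for q
    using that advance_cases(1)[OF r, of "t q" j "g q"] by (auto simp: K_def g'_def)
  have blk: "(\<lambda>i. pos s c (o' q) i div s) = c" "mirror_off s (pos s c (o' q)) = o' q" for c q
    using o'_less[of q] by (auto simp: pos_div mirror_off_pos)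
  have WE: "\<exists>q\<in>K. p = pos s (g q) (o' q) \<and> R p = pos s (g' q) (o' q) \<or>
      p = pos s (g' q) (o' q) \<and> R p = pos s (g q) (o' q)" if "p \<in> W" for p
    using that pair by (auto simp: W_def)
  have W_props: "R p \<in> W" "R p \<noteq> p" "u (R p) = u p" "r * s \<le> p j" "r * s + (u p + 1) * (2 * s) \<le> N"
    if pW: "p \<in> W" for p
  proof -
    obtain q where q: "q \<in> K" "p = pos s (g q) (o' q) \<and> R p = pos s (g' q) (o' q) \<or>
      p = pos s (g' q) (o' q) \<and> R p = pos s (g q) (o' q)" using WE[OF pW] by blast
    show "R p \<in> W" using q unfolding W_def by blast
    have "pos s (g q) (o' q) \<noteq> pos s (g' q) (o' q)"
      using gg'(1)[OF q(1)] blk(1)[of "g q" q] blk(1)[of "g' q" q] by auto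
    then show "R p \<noteq> p" using q(2) by metis
    show "u (R p) = u p" using q(2) pair[OF q(1)] by metis
    show "r * s \<le> p j" "r * s + (u p + 1) * (2 * s) \<le> N" using q(2) pair[OF q(1)] by blast+
  qed
  have finQ: "finite Q" using Q(1) finite_grid finite_subset by blast
  have Wgrid: "W \<subseteq> grid N"
  proof -
    have "pos s (g q) (o' q) \<in> grid N \<and> pos s (g' q) (o' q) \<in> grid N" if "q \<in> K" for q
      unfolding N(1) using pos_in_grid[OF o'_less[of q]] wQ(2)[of q] g'M[of q] that by (simp add: K_def)
    then show ?thesis by (auto simp: W_def)
  qed
  have cardW: "card W \<le> 2 * b"
  proof -
    have "card W \<le> (\<Sum>q\<in>K. card {pos s (g q) (o' q), pos s (g' q) (o' q)})"
      unfolding W_def using finQ by (intro card_UN_le) (simp add: K_def)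
    also have "\<dots> \<le> (\<Sum>q\<in>K. 2)" by (intro sum_mono) (simp add: card_insert_if)
    also have "\<dots> = 2 * card K" by simp
    also have "\<dots> \<le> 2 * card Q" using card_mono[OF finQ, of K] by (auto simp: K_def)
    finally show ?thesis using Q(2) by simp
  qed
  have rz: "reachable N (real (2 * s) * real N powr (- 1 - real CARD('d) / 2) * sqrt (card W / 2)) (card W) z"
  proof (rule reachable_reversal[where r = "r * s" and j = j, OF N(2)])
    show "0 < 2 * s" using s by simp
    show "W \<subseteq> grid N" by (rule Wgrid)
    show "\<forall>p\<in>W. r * s \<le> p j \<and> r * s + ((p j - r * s) div (2 * s) + 1) * (2 * s) \<le> N"
      using W_props(4,5) unfolding u_def by blast
    show "\<forall>p\<in>W. z p \<in> W \<and> z p \<noteq> p \<and> (\<forall>i. i \<noteq> j \<longrightarrow> z p i = p i) \<and>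
       (z p j - r * s) div (2 * s) = (p j - r * s) div (2 * s)"
    proof (intro ballI conjI allI impI)
      fix p i assume p: "p \<in> W"
      then have zp: "z p = R p" by (simp add: z_def)
      show "z p \<in> W" "z p \<noteq> p" using W_props[OF p] zp by auto
      show "i \<noteq> j \<Longrightarrow> z p i = p i" by (simp add: zp R_def)
      show "(z p j - r * s) div (2 * s) = (p j - r * s) div (2 * s)"
        using W_props(3)[OF p] by (simp add: zp u_def)
    qed
    show "\<forall>p\<in>W. \<forall>q\<in>W. (\<forall>i. i \<noteq> j \<longrightarrow> q i = p i) \<and>
       (q j - r * s) div (2 * s) = (p j - r * s) div (2 * s) \<and> p j < q j \<longrightarrow> z q j < z p j"
    proof (intro ballI impI)
      fix p q assume p: "p \<in> W" and q: "q \<in> W" and e: "(\<forall>i. i \<noteq> j \<longrightarrow> q i = p i) \<and>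
       (q j - r * s) div (2 * s) = (p j - r * s) div (2 * s) \<and> p j < q j"
      have "u q = u p" using e by (simp add: u_def)
      \<comment> \<open>This keeps \<open>q j\<close> in the range where the natural subtraction in
        \<open>R\<close> does not truncate, so that the order is strictly reversed.\<close>
      moreover have "q j - r * s < (u q + 1) * (2 * s)"
        using dividend_less_div_times[of "2 * s" "q j - r * s"] s
        unfolding u_def add_mult_distrib mult_1 by linarith
      then have "q j \<le> 2 * r * s + 4 * s * u q + 2 * s - 1"
        using W_props(4)[OF q] by (simp add: algebra_simps)
      moreover have "z q j = 2 * r * s + 4 * s * u q + 2 * s - 1 - q j"
        "z p j = 2 * r * s + 4 * s * u p + 2 * s - 1 - p j"
        using p q by (simp_all add: z_def R_def)
      ultimately show "z q j < z p j" using e by (simp only:) (rule diff_less_mono2; linarith)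
    qed
    show "\<forall>p. p \<notin> W \<longrightarrow> z p = p" by (simp add: z_def)
  qed
  have "real (2 * s) * real N powr (- 1 - real CARD('d) / 2) * sqrt (card W / 2)
      \<le> real (2 * s) * real N powr (- 1 - real CARD('d) / 2) * sqrt (real b)"
    using cardW by (intro mult_left_mono real_sqrt_le_mono) auto
  then have reach: "reachable N c (2 * b) z" using rz reachable_mono cardW c order_trans by blast
  have zw: "bij_betw (\<lambda>p. z (w p)) (grid N) (grid N)"
    using bij_betw_trans[OF w, of z "grid N"] reach by (simp add: reachable_def comp_def)
  have zQ: "z (w q) = pos s (g' q) (o' q)" if q: "q \<in> Q" for q
  proof (cases "q \<in> K")
    case True
    then have "w q \<in> W" using wQ(1)[OF q] by (auto simp: W_def)
    then show ?thesis using pair[OF True] wQ(1)[OF q] by (simp add: z_def)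
  next
    case False
    then have gq: "g' q = g q" using q by (simp add: K_def)
    \<comment> \<open>Both cells of a pair in \<open>W\<close> have the offset of their traveller,
      so a resting traveller could only meet itself there.\<close>
    have "w q \<notin> W"
    proof
      assume "w q \<in> W"
      then obtain q' where q': "q' \<in> K" "w q = pos s (g q') (o' q') \<or> w q = pos s (g' q') (o' q')"
        by (auto simp: W_def)
      then have "o' q = o' q'" using wQ(1)[OF q] blk(2) by metis
      then show False using injQ q q' False by (auto simp: K_def)
    qed
    then show ?thesis using wQ(1)[OF q] gq by (simp add: z_def)
  qed
  have zP: "o' (z (w p)) = o' p \<and> (\<forall>i. z (w p) i div s \<le> p i div s + 1 \<and> p i div s \<le> z (w p) i div s + 1) \<and>
     (\<forall>q\<in>Q. o' q = o' p \<longrightarrow> z (w p) = p \<or> block_dist (g' q) (t q) < block_dist (\<lambda>i. z (w p) i div s) (t q))"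
    if p: "p \<in> grid N - Q" for p
  proof (cases "w p \<in> W")
    case False
    then have zwp: "z (w p) = w p" by (simp add: z_def)
    have "block_dist (g' q) (t q) \<le> block_dist (g q) (t q)" for q
      unfolding g'_def by (rule advance_le[OF r])
    then show ?thesis unfolding zwp using wp[OF p] by (meson order.strict_trans1)
  next
    case True
    obtain q where q: "q \<in> K" "w p = pos s (g q) (o' q) \<and> R (w p) = pos s (g' q) (o' q) \<or>
      w p = pos s (g' q) (o' q) \<and> R (w p) = pos s (g q) (o' q)" using WE[OF True] by blast
    have qQ: "q \<in> Q" using q by (simp add: K_def)
    \<comment> \<open>That cell is occupied by the traveller itself, so \<open>p\<close> is its
      partner in the exchange.\<close>
    have "w p \<noteq> pos s (g q) (o' q)"
    proof
      assume "w p = pos s (g q) (o' q)"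
      then have "w p = w q" using wQ(1)[OF qQ] by simp
      then have "p = q" using w p qQ Q(1) by (auto simp: bij_betw_def dest: inj_onD)
      then show False using p qQ by simp
    qed
    then have wpe: "w p = pos s (g' q) (o' q)" "z (w p) = pos s (g q) (o' q)"
      using q(2) True by (auto simp: z_def)
    have op: "o' q = o' p" using wp(1)[OF p] unfolding wpe o'_def blk(2)[unfolded o'_def] by simp
    \<comment> \<open>The block \<open>g' q\<close> is closer to the target than \<open>g q\<close>,
      which excludes the second alternative of the invariant.\<close>
    have "w p = p"
      using wp(3)[OF p qQ op] gg'(2)[OF q(1)] unfolding wpe(1) blk(1) by auto
    then have pdiv: "p i div s = g' q i" for i using wpe(1) fun_cong[OF blk(1)[of "g' q" q], of i] by simp
    have zdiv: "z (w p) i div s = g q i" for i using wpe(2) fun_cong[OF blk(1)[of "g q" q], of i] by simp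
    have near: "g q i \<le> g' q i + 1 \<and> g' q i \<le> g q i + 1" for i
      by (auto simp: g'_def advance_def)
    show ?thesis
    proof (intro conjI allI ballI impI)
      show "o' (z (w p)) = o' p" unfolding wpe(2) using blk(2) op by (simp add: o'_def)
      show "z (w p) i div s \<le> p i div s + 1" "p i div s \<le> z (w p) i div s + 1" for i
        using near by (simp_all add: pdiv zdiv)
      fix q' assume q': "q' \<in> Q" "o' q' = o' p"
      then have "q' = q" using injQ qQ op by simp
      then show "z (w p) = p \<or> block_dist (g' q') (t q') < block_dist (\<lambda>i. z (w p) i div s) (t q')"
        using gg'(2)[OF q(1)] by (simp add: zdiv)
    qed
  qed
  have "routing_state M s Q t (\<lambda>p. z (w p)) g'"
    unfolding routing_state_def N(1)[symmetric] o'_def[symmetric] using zw zQ zP g'M by blast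
  moreover have "g' = (\<lambda>q. advance (t q) (j, r) (g q))" by (simp add: g'_def fun_eq_iff)
  ultimately show ?thesis using reach by blast
qed

lemma routing_steps:
  fixes Q :: "('d::finite \<Rightarrow> nat) set"
  assumes N: "N = M * s" "N > 0" and Q: "Q \<subseteq> grid N" "card Q \<le> b"
    and inj: "inj_on (mirror_off s) Q" and t: "\<forall>q\<in>Q. \<forall>i. t q i < M"
    and c: "real (2 * s) * real N powr (- 1 - real CARD('d) / 2) * sqrt (real b) \<le> c"
    and st: "routing_state M s Q t w g" and js: "\<forall>(j, r)\<in>set js. r < 2"
  shows "\<exists>z. reachable N (real (length js) * c) (2 * b * length js) z \<and>
    routing_state M s Q t (\<lambda>p. z (w p)) (\<lambda>q. fold (advance (t q)) js (g q))"
  using st js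
proof (induction js arbitrary: w g)
  case Nil
  then show ?case using reachable_id by (intro exI[of _ "\<lambda>p. p"]) simp
next
  case (Cons x js)
  obtain j r where x: "x = (j, r)" by (cases x)
  obtain z where z: "reachable N c (2 * b) z"
    "routing_state M s Q t (\<lambda>p. z (w p)) (\<lambda>q. advance (t q) (j, r) (g q))"
    using routing_step[OF N Q inj t c Cons.prems(1), of r j] Cons.prems(2) x by auto
  obtain z' where z': "reachable N (real (length js) * c) (2 * b * length js) z'"
    "routing_state M s Q t (\<lambda>p. z' (z (w p))) (\<lambda>q. fold (advance (t q)) js (advance (t q) (j, r) (g q)))"
    using Cons.IH[OF z(2)] Cons.prems(2) by auto
  have "reachable N (real (length (x # js)) * c) (2 * b * length (x # js)) (\<lambda>p. z' (z p))"
    using reachable_comp[OF N(2) z(1) z'(1)] by (simp add: algebra_simps)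
  then show ?case using z'(2) by (intro exI[of _ "\<lambda>p. z' (z p)"]) (simp add: x)
qed

text \<open>With \<nu> the dimension, \<open>T\<close> covers 2 \<nu> movements of spreading and 2
  \<nu>^2 M of routing, each moving at most \<open>2 * card Bad\<close> cells. For \<open>p\<close>
  outside \<open>Bad\<close>, spreading keeps \<open>F p\<close> in its block and routing then
  shifts it by at most one block in each direction, so coordinates change by less than
  \<open>2 * s\<close>.\<close>

theorem grid_routing:
  fixes F :: "('d::finite \<Rightarrow> nat) \<Rightarrow> 'd \<Rightarrow> nat"
  assumes N: "N = M * s" "N > 0" and F: "bij_betw F (grid N) (grid N)"
    and Bad: "Bad \<subseteq> grid N" "card Bad \<le> s ^ CARD('d)"
  defines "c \<equiv> real (2 * s) * real N powr (- 1 - real CARD('d) / 2) * sqrt (real (card Bad))"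
  defines "T \<equiv> 4 * CARD('d)\<^sup>2 * M"
  shows "\<exists>z. reachable N (real T * c) (2 * T * card Bad) z \<and>
    (\<forall>p\<in>Bad. \<forall>i. z (F p) i div s = p i div s) \<and>
    (\<forall>p\<in>grid N - Bad. \<forall>i. z (F p) i < F p i + 2 * s \<and> F p i < z (F p) i + 2 * s)"
proof -
  define d where "d = CARD('d)"
  define b where "b = card Bad"
  have d: "d > 0" by (simp add: d_def)
  have s: "s > 0" "M > 0" using N by (cases s; cases M; simp)+
  have F_Bad: "F ` Bad \<subseteq> grid N" "inj_on F Bad" "card (F ` Bad) = b"
  proof -
    show "F ` Bad \<subseteq> grid N" using F Bad(1) by (auto simp: bij_betw_def)
    show inj: "inj_on F Bad" using F Bad(1) by (auto simp: bij_betw_def intro: inj_on_subset)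
    show "card (F ` Bad) = b" using card_image[OF inj] by (simp add: b_def)
  qed
  have c: "real (2 * s) * real N powr (- 1 - real CARD('d) / 2) * sqrt (real b) \<le> c"
    by (simp add: c_def b_def)
  have c0: "0 \<le> c" by (simp add: c_def)
  obtain z0 where z0: "reachable N (2 * real d * c) (4 * d * b) z0" "\<forall>p i. z0 p i div s = p i div s"
    "\<forall>v. card {p \<in> z0 ` F ` Bad. \<forall>i. mirror_off s p i = v i} \<le> 1"
    using spread_offsets[OF N F_Bad(1), of b c UNIV] F_Bad(3) Bad(2) c by (auto simp: d_def b_def)
  define Q where "Q = z0 ` F ` Bad"
  have zb: "bij_betw z0 (grid N) (grid N)" using z0(1) by (simp add: reachable_def)
  have zF: "bij_betw (\<lambda>p. z0 (F p)) (grid N) (grid N)" using bij_betw_trans[OF F zb] by (simp add: comp_def)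
  have Qgrid: "Q \<subseteq> grid N" using zb F_Bad(1) by (auto simp: Q_def bij_betw_def)
  have finQ: "finite Q" using Qgrid finite_grid finite_subset by blast
  have cQ: "card Q \<le> b"
    unfolding Q_def using F_Bad(3) card_image_le[of "F ` Bad" z0] finite_subset[OF F_Bad(1) finite_grid] by simp
  have inj: "inj_on (mirror_off s) Q"
  proof (rule inj_onI)
    fix p q assume pq: "p \<in> Q" "q \<in> Q" "mirror_off s p = mirror_off s q"
    let ?A = "{p' \<in> Q. \<forall>i. mirror_off s p' i = mirror_off s p i}"
    have "card ?A \<le> 1" using z0(3) by (simp add: Q_def)
    moreover have "finite ?A" using finQ by simp
    ultimately show "p = q" using pq card_le_Suc0_iff_eq[of ?A] by auto
  qed
  \<comment> \<open>The traveller \<open>z0 (F p)\<close> has to go to the block of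
    \<open>p\<close>, where the bad cube came from; the inverse recovers \<open>p\<close>.\<close>
  define t where "t q = (\<lambda>i. inv_into Bad (\<lambda>p. z0 (F p)) q i div s)" for q
  have zFinj: "inj_on (\<lambda>p. z0 (F p)) Bad" using zF Bad(1) inj_on_subset by (auto simp: bij_betw_def)
  have tF: "t (z0 (F p)) = (\<lambda>i. p i div s)" if "p \<in> Bad" for p
    using inv_into_f_f[OF zFinj that] by (simp add: t_def)
  have div_less: "p i div s < M" if "p \<in> grid N" for p :: "'d \<Rightarrow> nat" and i
    using that N(1) by (simp add: grid_def less_mult_imp_div_less)
  have tM: "\<forall>q\<in>Q. \<forall>i. t q i < M"
  proof (intro ballI allI)
    fix q i assume "q \<in> Q"
    then obtain p where p: "p \<in> Bad" "q = z0 (F p)" by (auto simp: Q_def)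
    then show "t q i < M" using tF[OF p(1)] div_less[of p i] Bad(1) by auto
  qed
  define g where "g q = (\<lambda>i. q i div s)" for q :: "'d \<Rightarrow> nat"
  have st: "routing_state M s Q t (\<lambda>p. p) g"
    unfolding routing_state_def g_def
    using div_less Qgrid by (auto simp: bij_betw_def pos_mirror_off[OF s(1)])
  obtain ds :: "'d list" where ds: "set ds = UNIV" "distinct ds"
    using finite_distinct_list[of "UNIV :: 'd set"] by auto
  define js1 where "js1 = List.product ds [0, 1::nat]"
  have js1: "set js1 = UNIV \<times> {0, 1}" "length js1 = 2 * d"
    using ds distinct_card[OF ds(2)] by (auto simp: js1_def length_product d_def)
  \<comment> \<open>Block numbers are below \<open>M\<close> in each of the \<open>d\<close>
    directions, so no target is farther than \<open>d * M\<close>, and as many rounds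
    suffice.\<close>
  define js where "js = concat (replicate (d * M) js1)"
  have js: "\<forall>(j, r)\<in>set js. r < 2" using js1(1) by (auto simp: js_def)
  have len: "length js = 2 * d\<^sup>2 * M"
    by (simp add: js_def length_concat sum_list_replicate js1(2) power2_eq_square)
  obtain w where w: "reachable N (real (length js) * c) (2 * b * length js) w"
    "routing_state M s Q t w (\<lambda>q. fold (advance (t q)) js (g q))"
    using routing_steps[OF N Qgrid cQ inj tM c st js] by blast
  have arrive: "fold (advance (t q)) js (g q) = t q" if q: "q \<in> Q" for q
    unfolding js_def
  proof (rule fold_advance_rounds[OF js1(1)])
    have "(g q i - t q i) + (t q i - g q i) \<le> M" for i
    proof -
      have "t q i < M" "g q i < M" using tM q div_less[of q i] Qgrid by (auto simp: g_def)
      then show ?thesis by linarith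
    qed
    then have "block_dist (g q) (t q) \<le> (\<Sum>i\<in>(UNIV :: 'd set). M)"
      unfolding block_dist_def by (intro sum_mono)
    then show "block_dist (g q) (t q) \<le> d * M" by (simp add: d_def)
  qed
  have bad: "w (z0 (F p)) i div s = p i div s" if p: "p \<in> Bad" for p i
  proof -
    have q: "z0 (F p) \<in> Q" using p by (auto simp: Q_def)
    have "w (z0 (F p)) = pos s (t (z0 (F p))) (mirror_off s (z0 (F p)))"
      using w(2) q arrive[OF q] by (simp add: routing_state_def)
    then show ?thesis using tF[OF p] by (simp add: pos_div mirror_off_less[OF s(1)])
  qed
  have good: "w (z0 (F p)) i < F p i + 2 * s \<and> F p i < w (z0 (F p)) i + 2 * s"
    if p: "p \<in> grid N - Bad" for p i
  proof -
    let ?q = "z0 (F p)"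
    have "?q \<in> grid N" using zF p by (auto simp: bij_betw_def)
    moreover have "?q \<notin> Q"
    proof
      assume "?q \<in> Q"
      then obtain p' where "p' \<in> Bad" "z0 (F p) = z0 (F p')" by (auto simp: Q_def)
      then show False using zF p Bad(1) by (auto simp: bij_betw_def dest: inj_onD)
    qed
    ultimately have "w ?q i div s \<le> ?q i div s + 1 \<and> ?q i div s \<le> w ?q i div s + 1"
      using w(2) N(1) by (simp add: routing_state_def)
    then have le: "w ?q i div s \<le> F p i div s + 1" "F p i div s \<le> w ?q i div s + 1"
      using z0(2) by auto
    have bd: "k div s * s \<le> k" "k < (k div s + 1) * s" for k
      using s(1) dividend_less_div_times[of s k] by (simp_all add: algebra_simps)
    have "w ?q i < (F p i div s + 2) * s"
      using bd(2)[of "w ?q i"] mult_le_mono1[of "w ?q i div s + 1" "F p i div s + 2" s] le by linarith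
    moreover have "F p i < (w ?q i div s + 2) * s"
      using bd(2)[of "F p i"] mult_le_mono1[of "F p i div s + 1" "w ?q i div s + 2" s] le by linarith
    ultimately show ?thesis using bd(1)[of "F p i"] bd(1)[of "w ?q i"]
      unfolding add_mult_distrib by linarith
  qed
  have dM: "d \<le> d\<^sup>2 * M" using d s(2) by (simp add: power2_eq_square)
  have "reachable N (2 * real d * c + real (length js) * c) (4 * d * b + 2 * b * length js) (\<lambda>p. w (z0 p))"
    by (rule reachable_comp[OF N(2) z0(1) w(1)])
  moreover have "2 * real d * c + real (length js) * c \<le> real T * c"
  proof -
    have "2 * d + length js \<le> T" using dM unfolding len T_def d_def by linarith
    then have "real (2 * d + length js) * c \<le> real T * c" using c0 by (intro mult_right_mono) auto
    then show ?thesis by (simp add: algebra_simps)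
  qed
  moreover have "4 * d * b + 2 * b * length js \<le> 2 * T * card Bad"
  proof -
    have "4 * d + 2 * length js \<le> 2 * T" using dM unfolding len T_def d_def by linarith
    then have "(4 * d + 2 * length js) * b \<le> 2 * T * b" by (rule mult_le_mono1)
    then show ?thesis by (simp add: b_def algebra_simps)
  qed
  ultimately have "reachable N (real T * c) (2 * T * card Bad) (\<lambda>p. w (z0 p))"
    using reachable_mono by blast
  then show ?thesis using bad good by (intro exI[of _ "\<lambda>p. w (z0 p)"]) simp
qed

subsection \<open>Permutations of the cube and permutations of the grid\<close>

lemma emeasure_interior_cell:
  fixes p :: "'d::finite \<Rightarrow> nat"
  assumes "N > 0"
  shows "emeasure lebesgue (interior (cell N p)) = ennreal ((1 / real N) ^ CARD('d))"
proof -
  let ?a = "(\<chi> i. real (p i) / real N) :: real ^ 'd" and ?b = "(\<chi> i. real (p i + 1) / real N) :: real ^ 'd"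
  have "?a $ i \<le> ?b $ i" for i by (simp add: divide_right_mono)
  then have ne: "cbox ?a ?b \<noteq> {}" by (simp add: interval_ne_empty_cart)
  have "measure lborel (box ?a ?b) = measure lborel (cbox ?a ?b)"
    by (simp only: measure_lborel_box_eq measure_lborel_cbox_eq)
  also have "\<dots> = (\<Prod>i\<in>UNIV. ?b $ i - ?a $ i)" by (rule content_cbox_cart[OF ne])
  also have "\<dots> = (1 / real N) ^ CARD('d)" by (simp add: diff_divide_distrib[symmetric])
  finally have m: "measure lborel (box ?a ?b) = (1 / real N) ^ CARD('d)" .
  have "emeasure lborel (box ?a ?b) \<noteq> \<infinity>" by (simp add: emeasure_lborel_box_eq)
  then have "emeasure lborel (box ?a ?b) = ennreal ((1 / real N) ^ CARD('d))"
    unfolding m[symmetric] by (intro emeasure_eq_ennreal_measure) simp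
  then show ?thesis by (simp add: cell_def rectangle_def interior_cbox)
qed

lemma interior_cell_sets [simp]: "interior (cell N p) \<in> sets lebesgue"
  by (intro lmeasurable_open borel_open sets_completionI_sets) simp_all

lemma interior_cell_subset:
  assumes "N > 0" "p \<in> grid N"
  shows "interior (cell N p) \<subseteq> unit_cube"
proof
  fix x assume x: "x \<in> interior (cell N p)"
  have "0 \<le> x $ i \<and> x $ i \<le> 1" for i
  proof -
    have b: "real (p i) < real N * x $ i" "real N * x $ i < real (p i) + 1"
      using x assms by (auto simp: mem_interior_cell)
    have "p i < N" using assms by (simp add: grid_def)
    then have "real (p i) + 1 \<le> real N" by linarith
    then have "0 < real N * x $ i" "real N * x $ i < real N * 1" using b by linarith+
    then show ?thesis using assms(1) by (simp add: zero_less_mult_iff)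
  qed
  then show "x \<in> unit_cube" by (simp add: unit_cube_def mem_box_cart)
qed

lemma AE_in_cell:
  assumes N: "N > 0"
  shows "AE x in lebesgue. x \<in> (unit_cube :: (real ^ 'd::finite) set) \<longrightarrow> (\<exists>p\<in>grid N. x \<in> interior (cell N p))"
proof -
  let ?H = "(\<Union>i. \<Union>k\<in>{..N}. {x :: real ^ 'd. x $ i = real k / real N})"
  have "negligible {x :: real ^ 'd. x $ i = c}" for i c
    using negligible_standard_hyperplane[of "axis i 1 :: real ^ 'd" c]
    by (simp add: cart_eq_inner_axis axis_in_Basis_iff)
  then have "negligible ?H" by (auto intro!: negligible_Union)
  then have "?H \<in> null_sets lebesgue" by (simp add: negligible_iff_null_sets)
  then have "AE x in lebesgue. x \<notin> ?H" by (rule AE_not_in)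
  then show ?thesis
  proof (rule AE_mp, intro AE_I2 impI)
    fix x :: "real ^ 'd" assume x: "x \<notin> ?H" "x \<in> unit_cube"
    define p where "p i = nat \<lfloor>real N * x $ i\<rfloor>" for i
    have p: "p i < N \<and> real (p i) < real N * x $ i \<and> real N * x $ i < real (p i) + 1" for i
    proof -
      have x01: "0 \<le> x $ i" "x $ i \<le> 1" using x(2) by (auto simp: unit_cube_def mem_box_cart)
      then have nx: "0 \<le> real N * x $ i" "real N * x $ i \<le> real N"
        using N by (auto simp: mult_left_le)
      have rp: "real (p i) = of_int \<lfloor>real N * x $ i\<rfloor>" using nx by (simp add: p_def)
      have le: "real (p i) \<le> real N * x $ i" "real N * x $ i < real (p i) + 1"
        unfolding rp by linarith+
      have ne: "real N * x $ i \<noteq> real k" if "k \<le> N" for k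
        using x(1) that N by (auto simp: field_simps)
      have "p i \<le> N" using le nx by linarith
      then have "real (p i) < real N * x $ i" using le(1) ne by force
      moreover have "p i \<noteq> N" using calculation nx by auto
      ultimately show ?thesis using le \<open>p i \<le> N\<close> by auto
    qed
    show "\<exists>p\<in>grid N. x \<in> interior (cell N p)"
      using p by (intro bexI[of _ p]) (auto simp: mem_interior_cell[OF N] grid_def)
  qed
qed

lemma AE_lebesgue_on_iff:
  "S \<in> sets lebesgue \<Longrightarrow> (AE x in lebesgue_on S. Q x) \<longleftrightarrow> (AE x in lebesgue. x \<in> S \<longrightarrow> Q x)"
  by (rule AE_restrict_space_iff) simp

lemma unit_cube_sets [simp]: "(unit_cube :: (real ^ 'd::finite) set) \<in> sets lebesgue"
  by (simp add: unit_cube_def)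

text \<open>Lets statements that hold almost everywhere in the cube be checked one open cell at a
  time; what the open cells miss lies on finitely many hyperplanes.\<close>

lemma AE_unit_cube_iff:
  assumes N: "N > 0"
  shows "(AE x in lebesgue_on (unit_cube :: (real ^ 'd::finite) set). Q x) \<longleftrightarrow>
    (\<forall>p\<in>grid N. AE x in lebesgue. x \<in> interior (cell N p) \<longrightarrow> Q x)"
proof -
  have "(AE x in lebesgue. x \<in> (unit_cube :: (real ^ 'd) set) \<longrightarrow> Q x) \<longleftrightarrow>
      (AE x in lebesgue. \<forall>p\<in>grid N. x \<in> interior (cell N p) \<longrightarrow> Q x)"
  proof
    assume "AE x in lebesgue. x \<in> (unit_cube :: (real ^ 'd) set) \<longrightarrow> Q x"
    then show "AE x in lebesgue. \<forall>p\<in>grid N. x \<in> interior (cell N p) \<longrightarrow> Q x"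
      by (rule AE_mp) (use interior_cell_subset[OF N] in \<open>auto intro!: AE_I2\<close>)
  next
    assume "AE x in lebesgue. \<forall>p\<in>grid N. x \<in> interior (cell N p) \<longrightarrow> Q x"
    with AE_in_cell[OF N] show "AE x in lebesgue. x \<in> (unit_cube :: (real ^ 'd) set) \<longrightarrow> Q x"
      by eventually_elim blast
  qed
  then show ?thesis
    unfolding AE_lebesgue_on_iff[OF unit_cube_sets] AE_finite_all[OF finite_grid] .
qed

lemma emeasure_cells:
  fixes S :: "(real ^ 'd::finite) set"
  assumes N: "N > 0" and S: "S \<in> sets lebesgue" "S \<subseteq> unit_cube"
  shows "emeasure lebesgue S = (\<Sum>p\<in>grid N. emeasure lebesgue (S \<inter> interior (cell N p)))"
proof -
  have "emeasure lebesgue S = emeasure lebesgue (\<Union>p\<in>grid N. S \<inter> interior (cell N p))"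
  proof (rule emeasure_eq_AE)
    show "AE x in lebesgue. x \<in> S \<longleftrightarrow> x \<in> (\<Union>p\<in>grid N. S \<inter> interior (cell N p))"
      using AE_in_cell[OF N] by eventually_elim (use S(2) in auto)
    show "(\<Union>p\<in>grid N. S \<inter> interior (cell N p)) \<in> sets lebesgue"
      by (intro sets.finite_UN) (use S(1) in auto)
  qed (rule S(1))
  also have "\<dots> = (\<Sum>p\<in>grid N. emeasure lebesgue (S \<inter> interior (cell N p)))"
    by (rule sum_emeasure[symmetric])
      (use S(1) interior_cell_unique[OF N] in \<open>auto simp: disjoint_family_on_def\<close>)
  finally show ?thesis .
qed

definition cell_map where
  "cell_map N P F \<longleftrightarrow> (\<forall>p\<in>grid N. AE x in lebesgue. x \<in> interior (cell N p) \<longrightarrow> P x = x + grid_shift N p (F p))"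

lemma translates_to_iff:
  assumes "N > 0"
  shows "translates_to P (cell N p) (cell N q) \<longleftrightarrow>
    (AE x in lebesgue. x \<in> interior (cell N p) \<longrightarrow> P x = x + grid_shift N p q)"
  unfolding translates_to_def center_diff[OF assms, symmetric]
  by (simp add: AE_lebesgue_on_iff algebra_simps)

text \<open>If two cells were sent to the same cell, its preimage would contain both up to null sets
  and so have at least twice its measure, against measure preservation. On the finite grid
  injectivity gives bijectivity.\<close>

lemma permutations_cell_map:
  fixes P :: "real ^ 'd::finite \<Rightarrow> real ^ 'd"
  assumes N: "N > 0" and P: "P \<in> permutations N"
  shows "\<exists>F. bij_betw F (grid N) (grid N) \<and> cell_map N P F"
proof -
  let ?U = "lebesgue_on (unit_cube :: (real ^ 'd) set)"
  let ?v = "ennreal ((1 / real N) ^ CARD('d))"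
  have "\<forall>p\<in>grid N. \<exists>q\<in>grid N. translates_to P (cell N p) (cell N q)"
    using P by (auto simp: permutations_def cubes_eq)
  then obtain F where F: "\<And>p. p \<in> grid N \<Longrightarrow> F p \<in> grid N"
    "\<And>p. p \<in> grid N \<Longrightarrow> translates_to P (cell N p) (cell N (F p))" by metis
  have cm: "cell_map N P F" using F(2) by (auto simp: cell_map_def translates_to_iff[OF N])
  have inj: "inj_on F (grid N)"
  proof (rule inj_onI, rule ccontr)
    fix p p' assume p: "p \<in> grid N" "p' \<in> grid N" "F p = F p'" "p \<noteq> p'"
    let ?I = "interior (cell N (F p))"
    have Isub: "?I \<subseteq> unit_cube" using interior_cell_subset[OF N F(1)[OF p(1)]] .
    have Iset: "?I \<in> sets ?U" using Isub by (simp add: sets_restrict_space_iff)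
    define A where "A = P -` ?I \<inter> unit_cube"
    have Pm: "P \<in> ?U \<rightarrow>\<^sub>M ?U" "distr ?U ?U P = ?U" using P by (auto simp: permutations_def)
    have AU: "A \<in> sets ?U" using measurable_sets[OF Pm(1) Iset] by (simp add: A_def)
    then have A: "A \<in> sets lebesgue" "A \<subseteq> unit_cube" by (auto simp: sets_restrict_space_iff)
    have "emeasure ?U A = emeasure (distr ?U ?U P) ?I"
      using emeasure_distr[OF Pm(1) Iset] by (simp add: A_def)
    also have "\<dots> = emeasure lebesgue ?I"
      unfolding Pm(2) by (rule emeasure_restrict_space) (use Isub in auto)
    also have "\<dots> = ?v" by (rule emeasure_interior_cell[OF N])
    finally have Av: "emeasure lebesgue A = ?v"
      using emeasure_restrict_space[of unit_cube lebesgue A] A by simp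
    have part: "emeasure lebesgue (A \<inter> interior (cell N q)) = ?v" if q: "q \<in> grid N" "F q = F p" for q
    proof -
      have "emeasure lebesgue (A \<inter> interior (cell N q)) = emeasure lebesgue (interior (cell N q))"
      proof (rule emeasure_eq_AE)
        have "AE x in lebesgue. x \<in> interior (cell N q) \<longrightarrow> P x = x + grid_shift N q (F p)"
          using cm q by (auto simp: cell_map_def)
        then show "AE x in lebesgue. x \<in> A \<inter> interior (cell N q) \<longleftrightarrow> x \<in> interior (cell N q)"
          by eventually_elim
            (use shift_interior_cell[OF N] interior_cell_subset[OF N q(1)] in \<open>auto simp: A_def\<close>)
      qed (use A in auto)
      then show ?thesis using emeasure_interior_cell[OF N] by simp
    qed
    have "?v = (\<Sum>q\<in>grid N. emeasure lebesgue (A \<inter> interior (cell N q)))"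
      using emeasure_cells[OF N A] Av by simp
    also have "\<dots> \<ge> (\<Sum>q\<in>{p, p'}. emeasure lebesgue (A \<inter> interior (cell N q)))"
      using p by (intro sum_mono2) auto
    finally have "?v + ?v \<le> ?v" using p part by simp
    then have "(1 / real N) ^ CARD('d) + (1 / real N) ^ CARD('d) \<le> (1 / real N) ^ CARD('d)"
      by (simp flip: ennreal_plus)
    then show False using N by simp
  qed
  have "F ` grid N \<subseteq> grid N" using F(1) by blast
  then have "F ` grid N = grid N" by (rule endo_inj_surj[OF finite_grid _ inj])
  then have "bij_betw F (grid N) (grid N)" using inj by (simp add: bij_betw_def)
  then show ?thesis using cm by blast
qed

text \<open>The displacement is constant on each open cell, so the integral is a finite sum.\<close>

lemma L2_dist_cell_map:
  fixes P :: "real ^ 'd::finite \<Rightarrow> real ^ 'd"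
  assumes N: "N > 0" and P: "P \<in> permutations N" and cm: "cell_map N P F"
  shows "(L2_dist P id)\<^sup>2 = (1 / real N) ^ CARD('d) * (\<Sum>p\<in>grid N. (norm (grid_shift N p (F p)))\<^sup>2)"
proof -
  let ?U = "lebesgue_on (unit_cube :: (real ^ 'd) set)"
  let ?n = "\<lambda>p. (norm (grid_shift N p (F p)))\<^sup>2"
  have Pm: "P \<in> ?U \<rightarrow>\<^sub>M ?U" using P by (auto simp: permutations_def)
  have "P \<in> borel_measurable ?U"
    using measurable_compose[OF Pm id_borel_measurable_lebesgue_on] by simp
  then have m: "(\<lambda>x. (norm (P x - id x))\<^sup>2) \<in> borel_measurable ?U"
    using id_borel_measurable_lebesgue_on by measurable
  have Is: "interior (cell N p) \<in> sets ?U" if "p \<in> grid N" for p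
    using interior_cell_subset[OF N that] by (simp add: sets_restrict_space_iff)
  have mI: "measure ?U (interior (cell N p)) = (1 / real N) ^ CARD('d)" if "p \<in> grid N" for p
    using measure_restrict_space[of unit_cube lebesgue "interior (cell N p)"]
      interior_cell_subset[OF N that] emeasure_interior_cell[OF N, of p] by (simp add: measure_def)
  have eI: "emeasure ?U (interior (cell N p)) < \<infinity>" if "p \<in> grid N" for p
    using emeasure_restrict_space[of unit_cube lebesgue "interior (cell N p)"]
      interior_cell_subset[OF N that] emeasure_interior_cell[OF N, of p] by simp
  have "(LINT x|?U. (norm (P x - id x))\<^sup>2) = (LINT x|?U. (\<Sum>p\<in>grid N. ?n p * indicator (interior (cell N p)) x))"
  proof (rule integral_cong_AE[OF m])
    show "(\<lambda>x. \<Sum>p\<in>grid N. ?n p * indicator (interior (cell N p)) x) \<in> borel_measurable ?U"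
      by (intro borel_measurable_sum borel_measurable_times borel_measurable_const borel_measurable_indicator Is)
    show "AE x in ?U. (norm (P x - id x))\<^sup>2 = (\<Sum>p\<in>grid N. ?n p * indicator (interior (cell N p)) x)"
      unfolding AE_unit_cube_iff[OF N]
    proof
      fix p :: "'d \<Rightarrow> nat" assume p: "p \<in> grid N"
      then have "AE x in lebesgue. x \<in> interior (cell N p) \<longrightarrow> P x = x + grid_shift N p (F p)"
        using cm by (auto simp: cell_map_def)
      then show "AE x in lebesgue. x \<in> interior (cell N p) \<longrightarrow>
          (norm (P x - id x))\<^sup>2 = (\<Sum>p\<in>grid N. ?n p * indicator (interior (cell N p)) x)"
      proof (rule AE_mp, intro AE_I2 impI)
        fix x assume x: "x \<in> interior (cell N p) \<longrightarrow> P x = x + grid_shift N p (F p)" "x \<in> interior (cell N p)"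
        have "x \<in> interior (cell N q) \<longleftrightarrow> q = p" for q
          using interior_cell_unique[OF N x(2), of q] x(2) by blast
        then have "(\<Sum>q\<in>grid N. ?n q * indicator (interior (cell N q)) x) = (\<Sum>q\<in>grid N. if q = p then ?n p else 0)"
          by (intro sum.cong refl) (simp add: indicator_def)
        also have "\<dots> = ?n p" using p by simp
        finally show "(norm (P x - id x))\<^sup>2 = (\<Sum>p\<in>grid N. ?n p * indicator (interior (cell N p)) x)"
          using x by simp
      qed
    qed
  qed
  also have "\<dots> = (\<Sum>p\<in>grid N. (LINT x|?U. ?n p * indicator (interior (cell N p)) x))"
    using Is eI by (intro Bochner_Integration.integral_sum integrable_mult_right integrable_real_indicator) auto
  also have "\<dots> = (\<Sum>p\<in>grid N. ?n p * (1 / real N) ^ CARD('d))"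
  proof (rule sum.cong[OF refl])
    fix p :: "'d \<Rightarrow> nat" assume p: "p \<in> grid N"
    have "interior (cell N p) \<inter> unit_cube = interior (cell N p)" using interior_cell_subset[OF N p] by blast
    then show "(LINT x|?U. ?n p * indicator (interior (cell N p)) x) = ?n p * (1 / real N) ^ CARD('d)"
      using mI[OF p] by simp
  qed
  also have "\<dots> = (1 / real N) ^ CARD('d) * (\<Sum>p\<in>grid N. ?n p)"
    by (simp add: sum_distrib_left mult.commute)
  finally have e: "(LINT x|?U. (norm (P x - id x))\<^sup>2) = (1 / real N) ^ CARD('d) * (\<Sum>p\<in>grid N. ?n p)" .
  have "0 \<le> (1 / real N) ^ CARD('d) * (\<Sum>p\<in>grid N. ?n p)" by (intro mult_nonneg_nonneg sum_nonneg) auto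
  then show ?thesis unfolding L2_dist_def e by (rule real_sqrt_pow2)
qed

text \<open>Points outside the open cells stay fixed, so that the map sends every point of the cube
  into the cube, as measurability into \<open>lebesgue_on unit_cube\<close> demands.\<close>

definition perm_map :: "nat \<Rightarrow> (('d::finite \<Rightarrow> nat) \<Rightarrow> 'd \<Rightarrow> nat) \<Rightarrow> real ^ 'd \<Rightarrow> real ^ 'd" where
  "perm_map N G x = (if \<exists>p\<in>grid N. x \<in> interior (cell N p)
     then let p = (THE p. x \<in> interior (cell N p)) in x + grid_shift N p (G p) else x)"

lemma perm_map_cell:
  assumes "N > 0" "p \<in> grid N" "x \<in> interior (cell N p)"
  shows "perm_map N G x = x + grid_shift N p (G p)"
proof -
  have "(THE p. x \<in> interior (cell N p)) = p"
    using assms(3) interior_cell_unique[OF assms(1)] by blast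
  then show ?thesis using assms unfolding perm_map_def Let_def by auto
qed

lemma cell_map_perm_map: "N > 0 \<Longrightarrow> cell_map N (perm_map N G) G"
  by (simp add: cell_map_def perm_map_cell)

text \<open>Inside a cell the preimage of a set is a translate of the part of that set in the image
  cell; in the sum over all cells \<open>G\<close> only reorders the measures.\<close>

lemma perm_map_in_permutations:
  fixes G :: "('d::finite \<Rightarrow> nat) \<Rightarrow> 'd \<Rightarrow> nat"
  assumes N: "N > 0" and G: "bij_betw G (grid N) (grid N)"
  shows "perm_map N G \<in> permutations N"
proof -
  let ?U = "lebesgue_on (unit_cube :: (real ^ 'd) set)"
  let ?P = "perm_map N G"
  have Gg: "G p \<in> grid N" if "p \<in> grid N" for p using G that by (auto simp: bij_betw_def)
  have into: "?P x \<in> unit_cube" if "x \<in> unit_cube" for x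
  proof (cases "\<exists>p\<in>grid N. x \<in> interior (cell N p)")
    case True
    then obtain p where p: "p \<in> grid N" "x \<in> interior (cell N p)" by blast
    then show ?thesis
      using perm_map_cell[OF N p] shift_interior_cell[OF N p(2)] interior_cell_subset[OF N Gg[OF p(1)]] by auto
  next
    case False
    then show ?thesis using that by (simp add: perm_map_def)
  qed
  have pre: "?P -` A \<inter> interior (cell N p) = (+) (grid_shift N (G p) p) ` (A \<inter> interior (cell N (G p)))"
    if p: "p \<in> grid N" for A p
  proof (intro equalityI subsetI)
    fix x assume x: "x \<in> ?P -` A \<inter> interior (cell N p)"
    then have "x + grid_shift N p (G p) \<in> A \<inter> interior (cell N (G p))"
      using perm_map_cell[OF N p] shift_interior_cell[OF N] by auto
    moreover have "x = grid_shift N (G p) p + (x + grid_shift N p (G p))"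
      by (simp add: grid_shift_def vec_eq_iff diff_divide_distrib)
    ultimately show "x \<in> (+) (grid_shift N (G p) p) ` (A \<inter> interior (cell N (G p)))" by blast
  next
    fix x assume "x \<in> (+) (grid_shift N (G p) p) ` (A \<inter> interior (cell N (G p)))"
    then obtain y where y: "y \<in> A" "y \<in> interior (cell N (G p))" "x = grid_shift N (G p) p + y" by blast
    then have x: "x \<in> interior (cell N p)" using shift_interior_cell[OF N y(2)] by (simp add: add.commute)
    have "?P x = y"
      by (simp add: perm_map_cell[OF N p x]) (simp add: y(3) grid_shift_def vec_eq_iff diff_divide_distrib)
    then show "x \<in> ?P -` A \<inter> interior (cell N p)" using x y(1) by simp
  qed
  have sets: "?P -` A \<inter> unit_cube \<in> sets lebesgue" if A: "A \<in> sets lebesgue" for A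
  proof -
    let ?C = "\<Union>p\<in>grid N. interior (cell N p)"
    have C: "?C \<in> sets lebesgue" by (intro sets.finite_UN) auto
    have "?P -` A \<inter> unit_cube = (A \<inter> (unit_cube - ?C)) \<union> (\<Union>p\<in>grid N. ?P -` A \<inter> interior (cell N p))"
    proof (intro equalityI subsetI)
      fix x assume x: "x \<in> ?P -` A \<inter> unit_cube"
      then show "x \<in> (A \<inter> (unit_cube - ?C)) \<union> (\<Union>p\<in>grid N. ?P -` A \<inter> interior (cell N p))"
        by (cases "x \<in> ?C") (auto simp: perm_map_def)
    next
      fix x assume "x \<in> (A \<inter> (unit_cube - ?C)) \<union> (\<Union>p\<in>grid N. ?P -` A \<inter> interior (cell N p))"
      then show "x \<in> ?P -` A \<inter> unit_cube"
      proof
        assume "x \<in> A \<inter> (unit_cube - ?C)"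
        then show ?thesis by (auto simp: perm_map_def)
      next
        assume "x \<in> (\<Union>p\<in>grid N. ?P -` A \<inter> interior (cell N p))"
        then show ?thesis using interior_cell_subset[OF N] by blast
      qed
    qed
    also have "\<dots> \<in> sets lebesgue"
    proof (intro sets.Un sets.finite_UN finite_grid)
      show "A \<inter> (unit_cube - ?C) \<in> sets lebesgue" using A C by (intro sets.Int sets.Diff) auto
      fix p :: "'d \<Rightarrow> nat" assume p: "p \<in> grid N"
      show "?P -` A \<inter> interior (cell N p) \<in> sets lebesgue"
        unfolding pre[OF p] by (intro lebesgue_sets_translation sets.Int A) simp
    qed
    finally show ?thesis .
  qed
  have meas: "?P \<in> ?U \<rightarrow>\<^sub>M ?U"
  proof (rule measurableI)
    fix x assume "x \<in> space ?U" then show "?P x \<in> space ?U" using into by simp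
  next
    fix A assume "A \<in> sets ?U"
    then have "A \<in> sets lebesgue" by (simp add: sets_restrict_space_iff)
    then show "?P -` A \<inter> space ?U \<in> sets ?U" using sets by (simp add: sets_restrict_space_iff)
  qed
  have "distr ?U ?U ?P = ?U"
  proof (rule measure_eqI)
    fix A assume "A \<in> sets (distr ?U ?U ?P)"
    then have AU: "A \<in> sets ?U" by simp
    then have A: "A \<in> sets lebesgue" "A \<subseteq> unit_cube" by (auto simp: sets_restrict_space_iff)
    have trans: "emeasure lebesgue ((+) v ` S) = emeasure lebesgue S" for v :: "real ^ 'd" and S
      using emeasure_lebesgue_affine[of 1 v S] by (simp add: add.commute[of _ v] image_def)
    have "emeasure (distr ?U ?U ?P) A = emeasure ?U (?P -` A \<inter> unit_cube)"
      using emeasure_distr[OF meas AU] by simp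
    also have "\<dots> = emeasure lebesgue (?P -` A \<inter> unit_cube)"
      by (rule emeasure_restrict_space) auto
    also have "\<dots> = (\<Sum>p\<in>grid N. emeasure lebesgue (?P -` A \<inter> unit_cube \<inter> interior (cell N p)))"
      by (rule emeasure_cells[OF N sets[OF A(1)]]) auto
    also have "\<dots> = (\<Sum>p\<in>grid N. emeasure lebesgue (A \<inter> interior (cell N (G p))))"
    proof (rule sum.cong[OF refl])
      fix p :: "'d \<Rightarrow> nat" assume p: "p \<in> grid N"
      have "?P -` A \<inter> unit_cube \<inter> interior (cell N p) = ?P -` A \<inter> interior (cell N p)"
        using interior_cell_subset[OF N p] by blast
      then show "emeasure lebesgue (?P -` A \<inter> unit_cube \<inter> interior (cell N p))
          = emeasure lebesgue (A \<inter> interior (cell N (G p)))"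
        by (simp only: pre[OF p] trans)
    qed
    also have "\<dots> = (\<Sum>p\<in>grid N. emeasure lebesgue (A \<inter> interior (cell N p)))"
      by (rule sum.reindex_bij_betw[OF G])
    also have "\<dots> = emeasure lebesgue A" by (rule emeasure_cells[OF N A, symmetric])
    also have "\<dots> = emeasure ?U A"
      by (rule emeasure_restrict_space[symmetric]) (use A in auto)
    finally show "emeasure (distr ?U ?U ?P) A = emeasure ?U A" .
  qed simp
  moreover have "\<exists>K'\<in>cubes N. translates_to ?P K K'" if K: "K \<in> cubes N" for K
  proof -
    obtain p where p: "p \<in> grid N" "K = cell N p" using K by (auto simp: cubes_eq)
    have "translates_to ?P K (cell N (G p))"
      using cell_map_perm_map[OF N, of G] p by (simp add: translates_to_iff[OF N] cell_map_def)
    then show ?thesis using Gg[OF p(1)] by (auto simp: cubes_eq)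
  qed
  ultimately show ?thesis using meas by (simp add: permutations_def)
qed

text \<open>Two different translations cannot agree almost everywhere on a cell, which has positive
  measure; so the definite description has a unique solution.\<close>

lemma image_cube_cell:
  assumes N: "N > 0" and cm: "cell_map N P G" and p: "p \<in> grid N" "G p \<in> grid N"
  shows "image_cube N P (cell N p) = cell N (G p)"
  unfolding image_cube_def
proof (rule the_equality)
  have ae: "AE x in lebesgue. x \<in> interior (cell N p) \<longrightarrow> P x = x + grid_shift N p (G p)"
    using cm p by (simp add: cell_map_def)
  show "cell N (G p) \<in> cubes N \<and> translates_to P (cell N p) (cell N (G p))"
    using p ae by (simp add: cubes_eq translates_to_iff[OF N])
  fix K' assume K': "K' \<in> cubes N \<and> translates_to P (cell N p) K'"
  then obtain q where q: "K' = cell N q" by (auto simp: cubes_eq)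
  have ae': "AE x in lebesgue. x \<in> interior (cell N p) \<longrightarrow> P x = x + grid_shift N p q"
    using K' unfolding q translates_to_iff[OF N] by blast
  show "K' = cell N (G p)"
  proof (rule ccontr)
    assume "K' \<noteq> cell N (G p)"
    then have "q \<noteq> G p" unfolding q by blast
    then obtain i where "q i \<noteq> G p i" by blast
    then have "grid_shift N p q $ i \<noteq> grid_shift N p (G p) $ i"
      using N by (simp add: grid_shift_def)
    then have ne: "grid_shift N p q \<noteq> grid_shift N p (G p)" by metis
    have "AE x in lebesgue. x \<notin> interior (cell N p)"
      using ae ae' by eventually_elim (use ne in auto)
    then have "emeasure lebesgue {x \<in> space lebesgue. x \<in> interior (cell N p)} = 0"
      by (rule emeasure_eq_0_AE)
    then show False using emeasure_interior_cell[OF N, of p] N by simp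
  qed
qed

lemma flow_connects:
  fixes P :: "real ^ 'd::finite \<Rightarrow> real ^ 'd"
  assumes N: "N > 0" and F: "bij_betw F (grid N) (grid N)" and cm: "cell_map N P F" and ds: "flow_maps N ds z"
  shows "connects N ds P (perm_map N (\<lambda>p. z (F p)))"
  unfolding connects_def AE_unit_cube_iff[OF N]
proof
  fix p :: "'d \<Rightarrow> nat" assume p: "p \<in> grid N"
  then have "AE x in lebesgue. x \<in> interior (cell N p) \<longrightarrow> P x = x + grid_shift N p (F p)"
    using cm by (simp add: cell_map_def)
  then show "AE x in lebesgue. x \<in> interior (cell N p) \<longrightarrow>
      fold (movement_map N) ds (P x) = perm_map N (\<lambda>p. z (F p)) x"
  proof (rule AE_mp, intro AE_I2 impI)
    fix x assume x: "x \<in> interior (cell N p) \<longrightarrow> P x = x + grid_shift N p (F p)" "x \<in> interior (cell N p)"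
    have "F p \<in> grid N" using F p by (auto simp: bij_betw_def)
    then have "fold (movement_map N) ds (P x) = x + grid_shift N p (F p) + grid_shift N (F p) (z (F p))"
      using ds x shift_interior_cell[OF N x(2)] by (simp add: flow_maps_def)
    also have "\<dots> = perm_map N (\<lambda>p. z (F p)) x"
      unfolding perm_map_cell[OF N p x(2)] by (simp add: grid_shift_def vec_eq_iff diff_divide_distrib)
    finally show "fold (movement_map N) ds (P x) = perm_map N (\<lambda>p. z (F p)) x" .
  qed
qed

subsection \<open>Estimates\<close>

text \<open>Estimated through the l^1 norm, which brings the dimension as a factor into
  \<open>D\<close>.\<close>

lemma norm_grid_shift_le:
  fixes p q :: "'d::finite \<Rightarrow> nat"
  assumes N: "N > 0" and k: "\<forall>i. q i \<le> p i + k \<and> p i \<le> q i + k"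
  shows "norm (grid_shift N p q) \<le> real CARD('d) * (real k / real N)"
proof -
  have "norm (grid_shift N p q) \<le> (\<Sum>i\<in>UNIV. \<bar>grid_shift N p q $ i\<bar>)" by (rule norm_le_l1_cart)
  also have "\<dots> \<le> (\<Sum>i\<in>(UNIV :: 'd set). real k / real N)"
  proof (rule sum_mono)
    fix i
    have "q i \<le> p i + k" "p i \<le> q i + k" using k by auto
    then have "\<bar>real (q i) - real (p i)\<bar> \<le> real k" by linarith
    then show "\<bar>grid_shift N p q $ i\<bar> \<le> real k / real N"
      using N by (simp add: grid_shift_def abs_divide divide_right_mono)
  qed
  finally show ?thesis by simp
qed

lemma grid_shift_add: "grid_shift N p q + grid_shift N q r = grid_shift N p r"
  by (simp add: grid_shift_def vec_eq_iff diff_divide_distrib)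

text \<open>If \<open>z\<close> fixes \<open>F p\<close>, the term of \<open>p\<close> is unchanged.
  The other \<open>p\<close> are at most \<open>k\<close> because \<open>F\<close> is injective, and
  for them the crude bound \<open>r\<^sup>2\<close> replaces a comparison with the old
  displacement.\<close>

lemma shift_energy_after_routing:
  fixes F z :: "('d::finite \<Rightarrow> nat) \<Rightarrow> 'd \<Rightarrow> nat"
  assumes F: "bij_betw F (grid N) (grid N)" and k: "card {p \<in> grid N. z p \<noteq> p} \<le> k"
    and r: "\<And>p. p \<in> grid N \<Longrightarrow> norm (grid_shift N p (z (F p))) \<le> r"
  shows "(\<Sum>p\<in>grid N. (norm (grid_shift N p (z (F p))))\<^sup>2)
    \<le> (\<Sum>p\<in>grid N. (norm (grid_shift N p (F p)))\<^sup>2) + real k * r\<^sup>2"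
proof -
  let ?S = "{p \<in> grid N. z (F p) \<noteq> F p}"
  have "(\<Sum>p\<in>grid N. (norm (grid_shift N p (z (F p))))\<^sup>2)
      \<le> (\<Sum>p\<in>grid N. (norm (grid_shift N p (F p)))\<^sup>2 + (if z (F p) \<noteq> F p then r\<^sup>2 else 0))"
  proof (rule sum_mono)
    fix p :: "'d \<Rightarrow> nat" assume p: "p \<in> grid N"
    show "(norm (grid_shift N p (z (F p))))\<^sup>2 \<le> (norm (grid_shift N p (F p)))\<^sup>2 + (if z (F p) \<noteq> F p then r\<^sup>2 else 0)"
    proof (cases "z (F p) = F p")
      case False
      have "(norm (grid_shift N p (z (F p))))\<^sup>2 \<le> r\<^sup>2" using r[OF p] by (intro power_mono) auto
      then show ?thesis using False by (simp add: add_increasing)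
    qed simp
  qed
  also have "\<dots> = (\<Sum>p\<in>grid N. (norm (grid_shift N p (F p)))\<^sup>2) + real (card ?S) * r\<^sup>2"
    by (simp add: sum.distrib sum.If_cases Int_def)
  also have "real (card ?S) \<le> real k"
  proof -
    have "card ?S \<le> card {p \<in> grid N. z p \<noteq> p}"
    proof (rule card_inj_on_le[where f = F])
      show "inj_on F ?S" using F by (auto simp: bij_betw_def intro: inj_on_subset)
      show "F ` ?S \<subseteq> {p \<in> grid N. z p \<noteq> p}" using F by (auto simp: bij_betw_def)
    qed simp
    then show ?thesis using k by simp
  qed
  then have "(\<Sum>p\<in>grid N. (norm (grid_shift N p (F p)))\<^sup>2) + real (card ?S) * r\<^sup>2
      \<le> (\<Sum>p\<in>grid N. (norm (grid_shift N p (F p)))\<^sup>2) + real k * r\<^sup>2"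
    by (intro add_left_mono mult_right_mono) auto
  finally show ?thesis .
qed

text \<open>Chebyshev's inequality.\<close>

lemma card_large_shifts:
  fixes F :: "('d::finite \<Rightarrow> nat) \<Rightarrow> 'd \<Rightarrow> nat"
  assumes r: "r > 0"
  shows "real (card {p \<in> grid N. r < norm (grid_shift N p (F p))}) * r\<^sup>2
    \<le> (\<Sum>p\<in>grid N. (norm (grid_shift N p (F p)))\<^sup>2)"
proof -
  let ?B = "{p \<in> grid N. r < norm (grid_shift N p (F p))}"
  have "real (card ?B) * r\<^sup>2 = (\<Sum>p\<in>?B. r\<^sup>2)" by simp
  also have "\<dots> \<le> (\<Sum>p\<in>?B. (norm (grid_shift N p (F p)))\<^sup>2)"
    using r by (intro sum_mono power_mono) auto
  also have "\<dots> \<le> (\<Sum>p\<in>grid N. (norm (grid_shift N p (F p)))\<^sup>2)"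
    by (rule sum_mono2) auto
  finally show ?thesis .
qed

lemma smoothing_flow:
  fixes P :: "real ^ 'd::finite \<Rightarrow> real ^ 'd"
  assumes d: "d = CARD('d)" and eps: "0 < \<epsilon>" "\<epsilon> \<le> 2 / (2 + real d)" and del: "0 < \<delta>" "\<delta> \<le> 1"
    and N: "N = M * s" "N > 0" and scale: "\<delta> powr \<epsilon> * real N = real s"
    and P: "P \<in> permutations N" "L2_dist P id \<le> \<delta>"
  shows "\<exists>P' \<in> permutations N.
      L2_dist P' id \<le> (1 + 8 * (real d)\<^sup>2 * (1 + 2 * real d)\<^sup>2) * \<delta> powr (1 - \<epsilon> / 2) \<and>
      (\<forall>K\<in>cubes N. norm (center (image_cube N P' K) - center K) \<le> (1 + 2 * real d) * \<delta> powr \<epsilon>) \<and>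
      (\<exists>ds. discrete_flow N ds \<and> connects N ds P P' \<and>
            flow_length N ds \<le> 8 * (real d)\<^sup>2 * \<delta> powr (1 - \<epsilon>))"
proof -
  \<comment> \<open>\<open>h\<close> is the side of a block measured in the cube, so that
    \<open>M = 1 / h\<close>.\<close>
  define h where "h = \<delta> powr \<epsilon>"
  have h: "0 < h" "h * real N = real s" "real s / real N = h" "real M * h = 1"
  proof -
    show h0: "0 < h" using del by (simp add: h_def)
    show hN: "h * real N = real s" using scale by (simp add: h_def)
    then show "real s / real N = h" using N(2) by (simp add: field_simps)
    have "real s > 0" using N by (cases s) auto
    moreover have "h * (real M * real s) = real s" using hN N(1) by simp
    ultimately show "real M * h = 1" by (simp add: field_simps)
  qed
  obtain F where F: "bij_betw F (grid N) (grid N)" "cell_map N P F"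
    using permutations_cell_map[OF N(2) P(1)] by blast
  have Fg: "F p \<in> grid N" if "p \<in> grid N" for p using F(1) that by (auto simp: bij_betw_def)
  define E where "E = (\<Sum>p\<in>grid N. (norm (grid_shift N p (F p)))\<^sup>2)"
  define V where "V = real N ^ d"
  have V: "V > 0" using N(2) by (simp add: V_def)
  have L2P: "(L2_dist P id)\<^sup>2 = E / V"
    using L2_dist_cell_map[OF N(2) P(1) F(2)] by (simp add: E_def V_def d power_one_over)
  have "0 \<le> L2_dist P id" by (simp add: L2_dist_def)
  then have "E / V \<le> \<delta>\<^sup>2" unfolding L2P[symmetric] using P(2) by (intro power_mono)
  then have E: "E \<le> \<delta>\<^sup>2 * V" using V by (simp add: field_simps)
  define Bad where "Bad = {p \<in> grid N. h < norm (grid_shift N p (F p))}"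
  define b where "b = card Bad"
  have "real b * h\<^sup>2 \<le> E" unfolding b_def Bad_def E_def by (rule card_large_shifts[OF h(1)])
  then have bh: "real b * h\<^sup>2 \<le> \<delta>\<^sup>2 * V" using E by linarith
  have h2: "h\<^sup>2 = \<delta> powr (2 * \<epsilon>)" using del by (simp add: h_def power2_eq_square flip: powr_add)
  have d2: "\<delta>\<^sup>2 = \<delta> powr 2" using del by simp
  have bV: "real b \<le> \<delta> powr (2 - 2 * \<epsilon>) * V"
  proof -
    have eq: "\<delta>\<^sup>2 * V = (\<delta> powr (2 - 2 * \<epsilon>) * V) * h\<^sup>2"
      unfolding d2 h2 by (simp add: mult.assoc mult.left_commute flip: powr_add)
    have "real b * h\<^sup>2 \<le> (\<delta> powr (2 - 2 * \<epsilon>) * V) * h\<^sup>2" using bh unfolding eq .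
    then show ?thesis using h(1) by (simp add: mult_le_cancel_right)
  qed
  \<comment> \<open>This is \<open>\<epsilon> * d \<le> 2 - 2 * \<epsilon>\<close>; as
    \<open>\<delta> \<le> 1\<close>, the larger exponent gives the smaller power.\<close>
  have "\<epsilon> * (2 + real d) \<le> 2" using eps by (simp add: field_simps)
  then have "\<delta> powr (2 - 2 * \<epsilon>) \<le> \<delta> powr (\<epsilon> * real d)"
    using del by (intro powr_mono') (auto simp: algebra_simps)
  also have "\<dots> = h ^ d" using del by (simp add: h_def powr_powr flip: powr_realpow)
  finally have "real b \<le> h ^ d * V" using bV V by (meson mult_right_mono less_imp_le order_trans)
  also have "\<dots> = real s ^ d" by (simp add: V_def h(2)[symmetric] power_mult_distrib)
  finally have bs: "b \<le> s ^ CARD('d)" unfolding d[symmetric] by (simp flip: of_nat_power)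
  define T where "T = 4 * d\<^sup>2 * M"
  define c where "c = real (2 * s) * real N powr (- 1 - real d / 2) * sqrt (real b)"
  obtain z where z: "reachable N (real T * c) (2 * T * b) z"
    "\<forall>p\<in>Bad. \<forall>i. z (F p) i div s = p i div s"
    "\<forall>p\<in>grid N - Bad. \<forall>i. z (F p) i < F p i + 2 * s \<and> F p i < z (F p) i + 2 * s"
    using grid_routing[OF N F(1), of Bad] bs unfolding T_def c_def b_def d Bad_def by blast
  define G where "G p = z (F p)" for p
  define P' where "P' = perm_map N G"
  have zb: "bij_betw z (grid N) (grid N)" using z(1) by (simp add: reachable_def)
  have G: "bij_betw G (grid N) (grid N)"
    using bij_betw_trans[OF F(1) zb] by (simp add: comp_def G_def[abs_def])
  have Gg: "G p \<in> grid N" if "p \<in> grid N" for p using G that by (auto simp: bij_betw_def)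
  have P'P: "P' \<in> permutations N" unfolding P'_def by (rule perm_map_in_permutations[OF N(2) G])
  have P'c: "cell_map N P' G" unfolding P'_def by (rule cell_map_perm_map[OF N(2)])
  \<comment> \<open>A good cube is displaced by at most \<open>h\<close> under \<open>P\<close> and
    then by at most \<open>2 * d * h\<close> by the flow; a bad cube ends in its own block, within
    \<open>d * h\<close>.\<close>
  define D where "D = 1 + 2 * real d"
  have s0: "s > 0" using N by (cases s) auto
  have disp: "norm (grid_shift N p (z (F p))) \<le> D * h" if p: "p \<in> grid N" for p
  proof (cases "p \<in> Bad")
    case True
    have "z (F p) i \<le> p i + s \<and> p i \<le> z (F p) i + s" for i
    proof -
      have e: "z (F p) i div s = p i div s" using z(2) True by blast
      have "z (F p) i mod s < s" "p i mod s < s" using s0 by auto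
      then show ?thesis
        using div_mult_mod_eq[of "z (F p) i" s] div_mult_mod_eq[of "p i" s] unfolding e by linarith
    qed
    then have "norm (grid_shift N p (z (F p))) \<le> real d * (real s / real N)"
      using norm_grid_shift_le[OF N(2), of "z (F p)" p s] by (simp add: d)
    also have "\<dots> = real d * h" by (simp only: h(3))
    also have "\<dots> \<le> D * h" using h(1) by (intro mult_right_mono) (auto simp: D_def)
    finally show ?thesis .
  next
    case False
    have "z (F p) i \<le> F p i + 2 * s \<and> F p i \<le> z (F p) i + 2 * s" for i
      using z(3) p False by (simp add: less_imp_le)
    then have 1: "norm (grid_shift N (F p) (z (F p))) \<le> real d * (real (2 * s) / real N)"
      using norm_grid_shift_le[OF N(2), of "z (F p)" "F p" "2 * s"] by (simp add: d)
    have "real d * (real (2 * s) / real N) = 2 * real d * h" by (simp add: h(3)[symmetric])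
    moreover have "norm (grid_shift N p (F p)) \<le> h" using False p by (simp add: Bad_def)
    moreover have "norm (grid_shift N p (z (F p))) \<le> norm (grid_shift N p (F p)) + norm (grid_shift N (F p) (z (F p)))"
      unfolding grid_shift_add[of N p "F p" "z (F p)", symmetric] by (rule norm_triangle_ineq)
    moreover have "D * h = h + 2 * real d * h" by (simp add: D_def algebra_simps)
    ultimately show ?thesis using 1 by linarith
  qed
  have L2: "L2_dist P' id \<le> (1 + 8 * (real d)\<^sup>2 * D\<^sup>2) * \<delta> powr (1 - \<epsilon> / 2)"
  proof -
    let ?K = "8 * (real d)\<^sup>2 * D\<^sup>2"
    have "(\<Sum>p\<in>grid N. (norm (grid_shift N p (z (F p))))\<^sup>2) \<le> E + real (2 * T * b) * (D * h)\<^sup>2"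
      unfolding E_def by (rule shift_energy_after_routing[OF F(1) _ disp]) (use z(1) in \<open>simp add: reachable_def\<close>)
    moreover have "real (2 * T * b) * (D * h)\<^sup>2 = ?K * real M * (real b * h\<^sup>2)"
      by (simp add: T_def power_mult_distrib)
    moreover have "?K * real M * (real b * h\<^sup>2) \<le> ?K * real M * (\<delta>\<^sup>2 * V)"
      using bh by (intro mult_left_mono) auto
    ultimately have "(\<Sum>p\<in>grid N. (norm (grid_shift N p (G p)))\<^sup>2) \<le> \<delta>\<^sup>2 * V + ?K * real M * (\<delta>\<^sup>2 * V)"
      using E unfolding G_def by linarith
    also have "\<dots> = (\<delta>\<^sup>2 + ?K * real M * \<delta>\<^sup>2) * V" by (simp add: distrib_right)
    finally have "(\<Sum>p\<in>grid N. (norm (grid_shift N p (G p)))\<^sup>2) / V \<le> \<delta>\<^sup>2 + ?K * real M * \<delta>\<^sup>2"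
      by (simp only: pos_divide_le_eq[OF V])
    then have "(L2_dist P' id)\<^sup>2 \<le> \<delta>\<^sup>2 + ?K * real M * \<delta>\<^sup>2"
      using L2_dist_cell_map[OF N(2) P'P P'c] by (simp add: V_def d power_one_over)
    also have "\<dots> \<le> (1 + ?K) * (real M * \<delta>\<^sup>2)"
    proof -
      have "M \<ge> 1" using N by (cases M) auto
      then have "1 * \<delta>\<^sup>2 \<le> real M * \<delta>\<^sup>2" by (intro mult_right_mono) auto
      then show ?thesis by (simp add: algebra_simps)
    qed
    \<comment> \<open>With \<open>M = \<delta> powr (- \<epsilon>)\<close> this is
      \<open>\<delta> powr (2 - \<epsilon>)\<close>, whose square root is the power in (i).\<close>
    also have "real M * \<delta>\<^sup>2 = (\<delta> powr (1 - \<epsilon> / 2))\<^sup>2"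
    proof -
      have "real M = \<delta> powr (- \<epsilon>)" using h(1,4) by (simp add: h_def powr_minus field_simps)
      then show ?thesis
        unfolding d2 by (simp add: power2_eq_square flip: powr_add)
    qed
    \<comment> \<open>Squaring a constant that is at least 1 only enlarges it; this avoids a square
      root in the constant of (i).\<close>
    also have "(1 + ?K) * (\<delta> powr (1 - \<epsilon> / 2))\<^sup>2 \<le> ((1 + ?K) * \<delta> powr (1 - \<epsilon> / 2))\<^sup>2"
    proof -
      have "1 \<le> 1 + ?K" by simp
      then have "1 + ?K \<le> (1 + ?K)\<^sup>2" by (rule self_le_power) simp
      then show ?thesis unfolding power_mult_distrib by (intro mult_right_mono) auto
    qed
    finally show ?thesis by (rule power2_le_imp_le) (simp add: add_nonneg_nonneg)
  qed
  have cubes: "norm (center (image_cube N P' K) - center K) \<le> D * \<delta> powr \<epsilon>" if K: "K \<in> cubes N" for K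
  proof -
    obtain p where p: "p \<in> grid N" "K = cell N p" using K by (auto simp: cubes_eq)
    show ?thesis
      unfolding p(2) image_cube_cell[OF N(2) P'c p(1) Gg[OF p(1)]] center_diff[OF N(2)]
      using disp[OF p(1)] by (simp add: G_def h_def)
  qed
  obtain ds where ds: "discrete_flow N ds" "flow_length N ds \<le> real T * c" "flow_maps N ds z"
    using z(1) by (auto simp: reachable_def)
  have conn: "connects N ds P P'"
    using flow_connects[OF N(2) F(1,2) ds(3)] by (simp add: P'_def G_def[abs_def])
  have len: "real T * c \<le> 8 * (real d)\<^sup>2 * \<delta> powr (1 - \<epsilon>)"
  proof -
    have N0: "real N > 0" using N(2) by simp
    \<comment> \<open>\<open>T\<close> contributes a factor \<open>M\<close> and \<open>c\<close> a
      factor \<open>s\<close>; their product \<open>N\<close> cancels against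
      \<open>N powr (- 1)\<close>, and the remaining power of \<open>N\<close> against that in the
      bound for \<open>sqrt b\<close>.\<close>
    have "real M * real s = real N" using N(1) by simp
    then have "real T * c = 8 * (real d)\<^sup>2 * (real N * real N powr (- 1 - real d / 2) * sqrt (real b))"
      by (simp add: T_def c_def)
    also have "real N * real N powr (- 1 - real d / 2) = real N powr 1 * real N powr (- 1 - real d / 2)"
      using N0 by simp
    also have "\<dots> = real N powr (- (real d / 2))" unfolding powr_add[symmetric] by simp
    also have "real N powr (- (real d / 2)) * sqrt (real b) \<le> \<delta> powr (1 - \<epsilon>)"
    proof -
      have "sqrt (real b) \<le> sqrt (\<delta> powr (2 - 2 * \<epsilon>) * V)" using bV by simp
      also have "\<dots> = \<delta> powr (1 - \<epsilon>) * real N powr (real d / 2)"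
      proof -
        have "sqrt (\<delta> powr (2 - 2 * \<epsilon>)) = \<delta> powr (1 - \<epsilon>)"
          by (rule real_sqrt_unique) (simp_all add: power2_eq_square flip: powr_add)
        moreover have "sqrt V = real N powr (real d / 2)"
          unfolding V_def using N0
          by (intro real_sqrt_unique) (simp_all add: power2_eq_square powr_realpow flip: powr_add)
        ultimately show ?thesis by (simp add: real_sqrt_mult)
      qed
      finally have "real N powr (- (real d / 2)) * sqrt (real b)
          \<le> real N powr (- (real d / 2)) * (\<delta> powr (1 - \<epsilon>) * real N powr (real d / 2))"
        by (intro mult_left_mono) auto
      also have "\<dots> = \<delta> powr (1 - \<epsilon>)"
        using N0 by (simp add: powr_minus field_simps)
      finally show ?thesis .
    qed
    finally show ?thesis by (simp add: mult_left_mono)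
  qed
  show ?thesis
    using P'P L2 cubes ds(1) conn ds(2) len unfolding D_def by (meson order_trans)
qed

theorem proposition1p9:
  assumes "CARD('d::finite) \<ge> 2"
  shows "\<exists>\<delta>\<^sub>0 C D C' :: real. 0 < \<delta>\<^sub>0 \<and> \<delta>\<^sub>0 < 1 \<and> 0 < C \<and> 0 < D \<and> 0 < C' \<and>
    (\<forall>(\<epsilon>::real) (\<delta>::real) (n::nat) (m::nat) (N::nat) (P :: real ^ 'd \<Rightarrow> real ^ 'd).
       0 < \<epsilon> \<and> \<epsilon> \<le> 2 / (2 + real CARD('d)) \<and> 0 < \<delta> \<and> \<delta> \<le> \<delta>\<^sub>0 \<and>
       N = 2 ^ n \<and> m \<le> n \<and> \<delta> powr \<epsilon> * real N = 2 ^ m \<and>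
       P \<in> permutations N \<and> L2_dist P id \<le> \<delta> \<longrightarrow>
       (\<exists>P' \<in> permutations N.
          L2_dist P' id \<le> C * \<delta> powr (1 - \<epsilon> / 2) \<and>
          (\<forall>K\<in>cubes N. norm (center (image_cube N P' K) - center K) \<le> D * \<delta> powr \<epsilon>) \<and>
          (\<exists>ds. discrete_flow N ds \<and> connects N ds P P' \<and>
                flow_length N ds \<le> C' * \<delta> powr (1 - \<epsilon>))))"
proof (intro exI conjI allI impI)
  let ?d = "real CARD('d)"
  \<comment> \<open>\<open>smoothing_flow\<close> reaches up to \<open>\<delta> = 1\<close>; the
    value 1/2 keeps \<open>\<delta>\<^sub>0\<close> below 1.\<close>
  show "0 < (1 / 2 :: real)" "(1 / 2 :: real) < 1" by simp_all
  show "0 < 1 + 8 * ?d\<^sup>2 * (1 + 2 * ?d)\<^sup>2" by (intro add_pos_nonneg) auto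
  show "0 < 1 + 2 * ?d" by (intro add_pos_nonneg) auto
  show "0 < 8 * ?d\<^sup>2" by simp
  fix \<epsilon> \<delta> :: real and n m N :: nat and P :: "real ^ 'd \<Rightarrow> real ^ 'd"
  assume H: "0 < \<epsilon> \<and> \<epsilon> \<le> 2 / (2 + real CARD('d)) \<and> 0 < \<delta> \<and> \<delta> \<le> 1 / 2 \<and>
       N = 2 ^ n \<and> m \<le> n \<and> \<delta> powr \<epsilon> * real N = 2 ^ m \<and>
       P \<in> permutations N \<and> L2_dist P id \<le> \<delta>"
  \<comment> \<open>Here \<open>s = 2 ^ m\<close> and \<open>M = 2 ^ (n - m)\<close>, which equals
    \<open>\<delta> powr (- \<epsilon>)\<close>.\<close>
  then have NMs: "N = 2 ^ (n - m) * 2 ^ m" by (simp flip: power_add)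
  show "\<exists>P' \<in> permutations N.
      L2_dist P' id \<le> (1 + 8 * ?d\<^sup>2 * (1 + 2 * ?d)\<^sup>2) * \<delta> powr (1 - \<epsilon> / 2) \<and>
      (\<forall>K\<in>cubes N. norm (center (image_cube N P' K) - center K) \<le> (1 + 2 * ?d) * \<delta> powr \<epsilon>) \<and>
      (\<exists>ds. discrete_flow N ds \<and> connects N ds P P' \<and>
            flow_length N ds \<le> 8 * ?d\<^sup>2 * \<delta> powr (1 - \<epsilon>))"
    by (rule smoothing_flow[OF refl, where s = "2 ^ m", OF _ _ _ _ NMs]) (use H in auto)
qed

end
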